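(* Let $0<\lambda\le 1$, $a\in\mathbb{C}$, and let $F:\mathbb{C}^2\to\mathbb{C}^2$, $F(z,w)=(z-z^2,\ \lambda w-2zw+aw^2)$. Let $\Omega$ be the attracting basin of $F$ at $(0,0)$, and let $S$ be the grand orbit of $(1/2,0)$ under $F$. Then for every connected component $\Omega_\alpha$ of $\Omega$ and every constant $C>0$ there exists a point $(z_0,w_\alpha)\in\Omega_\alpha$ such that for every $(\tilde z,\tilde w)\in S\cap\Omega_\alpha$ the Kobayashi distance satisfies $d_{\Omega_\alpha}\big((z_0,w_\alpha),(\tilde z,\tilde w)\big)\ge C$.
   Context: The attracting basin $\Omega$ of $F$ at $(0,0)$ is the set of points of $\mathbb{C}^2$ having an open neighborhood on which the iterates $F^n$ converge uniformly to the constant $(0,0)$; it is an open set. The grand orbit of a point $p$ under $F$ is the set of all $q\in\mathbb{C}^2$ such that $F^m(q)=F^n(p)$ for some integers $m,n\ge 0$. $d_{\Omega_\alpha}$ denotes the Kobayashi (pseudo)distance of the domain $\Omega_\alpha$. *)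

theory Defs
  imports "HOL-Analysis.Analysis"
begin

definition F_map :: "real \<Rightarrow> complex \<Rightarrow> complex \<times> complex \<Rightarrow> complex \<times> complex" where
  "F_map lam a = (\<lambda>(z, w). (z - z\<^sup>2, of_real lam * w - 2 * z * w + a * w\<^sup>2))"

definition attracting_basin ::
  "('a::metric_space \<Rightarrow> 'a) \<Rightarrow> 'a \<Rightarrow> 'a set" where
  "attracting_basin f p =
     {x. \<exists>U. open U \<and> x \<in> U \<and> uniform_limit U (\<lambda>n. f ^^ n) (\<lambda>_. p) sequentially}"

definition grand_orbit :: "('a \<Rightarrow> 'a) \<Rightarrow> 'a \<Rightarrow> 'a set" where
  "grand_orbit f p = {q. \<exists>m n. (f ^^ m) q = (f ^^ n) p}"

text \<open>The Poincare distance is normalised by the metric $|dz|/(1-|z|^2)$ (curvature $-4$).\<close>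

definition poincare_dist :: "complex \<Rightarrow> complex \<Rightarrow> real" where
  "poincare_dist a b = artanh (cmod ((a - b) / (1 - cnj a * b)))"

definition holomorphic_disc ::
  "(complex \<times> complex) set \<Rightarrow> (complex \<Rightarrow> complex \<times> complex) \<Rightarrow> bool" where
  "holomorphic_disc X f \<longleftrightarrow>
     (\<lambda>t. fst (f t)) holomorphic_on ball 0 1 \<and>
     (\<lambda>t. snd (f t)) holomorphic_on ball 0 1 \<and>
     f ` ball 0 1 \<subseteq> X"

text \<open>Infimum of the Poincare lengths of chains of holomorphic discs joining \<open>p\<close> to \<open>q\<close>.
  On a domain such chains always exist; the value \<open>\<infinity>\<close> (infimum of the empty set) occurs only when
  \<open>p\<close> and \<open>q\<close> do not lie in one connected component of the open set \<open>X\<close>.\<close>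

definition kobayashi_dist ::
  "(complex \<times> complex) set \<Rightarrow> complex \<times> complex \<Rightarrow> complex \<times> complex \<Rightarrow> ereal" where
  "kobayashi_dist X p q =
     Inf {ereal (\<Sum>i<k. poincare_dist (a i) (b i)) | k x f a b.
            k \<ge> 1 \<and> x 0 = p \<and> x k = q \<and>
            (\<forall>i<k. holomorphic_disc X (f i) \<and> a i \<in> ball 0 1 \<and> b i \<in> ball 0 1 \<and>
                   f i (a i) = x i \<and> f i (b i) = x (Suc i))}"

end

theory Submission
  imports Defs "HOL-Complex_Analysis.Complex_Analysis"
begin

text \<open>
  The first coordinate semiconjugates \<open>F\<close> to the parabolic polynomial \<open>p z = z - z\<^sup>2\<close>
  (\<open>base_map\<close>), so the distance can be estimated in the plane. Since \<open>p\<close> drives every real number outside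
  \<open>[0, 1]\<close> to \<open>- \<infinity>\<close>, the basin of \<open>p\<close>, being open, omits \<open>(- \<infinity>, 0]\<close> and
  \<open>[1, \<infinity>)\<close>; hence
  \<open>v = sqrt (1 / z - 1)\<close> maps it holomorphically into the right half-plane. By the Schwarz-Pick
  lemma the map \<open>(z, w) \<mapsto> v (p\<^sup>k z)\<close> does not increase distances, for any \<open>k\<close>, and distances in the
  half-plane are explicit.

  In the coordinate \<open>u = 1 / z\<close> the polynomial acts as \<open>u \<mapsto> u + 1 + 1 / (u - 1)\<close>, nearly a
  translation. There is a height \<open>c\<close> such that an orbit starting with \<open>Im u > c\<close> stays in the upper
  half-plane forever, and therefore never becomes real. The orbit of \<open>1 / 2\<close> is real, so every point of the
  grand orbit satisfies \<open>\<bar>Im u\<bar> \<le> c\<close>, that is \<open>\<bar>Im (v\<^sup>2)\<bar> \<le> c\<close>. At height about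
  \<open>t\<close> this region of the half-plane is within distance \<open>c / t\<close> of the imaginary axis. So the
  hyperbolic distance from \<open>1 + \<i> t\<close> to the region tends to infinity with \<open>t\<close>.

  It remains to show that every component of the basin of \<open>F\<close> contains a point whose base coordinate
  is eventually mapped by \<open>p\<close> to the \<open>z\<close> with \<open>v = 1 + \<i> t\<close>. For \<open>a \<noteq> 0\<close> the map \<open>F\<close> is open and
  proper, hence it maps components of its basin onto components, and one component contains both
  \<open>(z, 0)\<close> and the neighbourhood \<open>{\<bar>w\<bar> < \<epsilon> \<bar>z\<bar>}\<close> of an attracting petal in the axis. A suitable orbit from
  each component enters this neighbourhood. For \<open>\<lambda> < 1\<close> this is so because \<open>w / z\<close> decays geometrically. For
  \<open>\<lambda> = 1\<close> the function \<open>d = z - a w\<close> satisfies \<open>d \<circ> F = p \<circ> d\<close>, so \<open>z\<close> and \<open>d\<close> follow two orbits of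
  \<open>p\<close>, both asymptotic to \<open>1 / n\<close> unless \<open>d\<close> vanishes; thus \<open>a w / z = 1 - d / z\<close> tends to \<open>0\<close>. For
  \<open>a = 0\<close> the basin is the product of the basin of \<open>p\<close> with the plane, and the same argument is applied to \<open>p\<close>.
\<close>

section \<open>Lower bounds for the Kobayashi distance\<close>

lemma artanh_real_mono:
  fixes x y :: real
  assumes "- 1 < x" "x \<le> y" "y < 1"
  shows "artanh x \<le> artanh y"
proof -
  have "(1 + x) / (1 - x) \<le> (1 + y) / (1 - y)"
    using assms by (simp add: field_simps)
  moreover have "0 < (1 + x) / (1 - x)"
    using assms by simp
  ultimately have "ln ((1 + x) / (1 - x)) \<le> ln ((1 + y) / (1 - y))"
    using ln_mono by blast
  then show ?thesis
    by (simp add: artanh_def)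
qed

text \<open>The addition theorem, from \<open>exp (2 artanh x) = (1 + x) / (1 - x)\<close>: the Moebius sum
  \<open>(x + y) / (1 + x y)\<close> multiplies these quotients.\<close>

lemma artanh_real_add:
  fixes x y :: real
  assumes x: "\<bar>x\<bar> < 1" and y: "\<bar>y\<bar> < 1"
  shows "artanh ((x + y) / (1 + x * y)) = artanh x + artanh y"
proof -
  have xy: "0 < 1 + x * y"
    using abs_mult_less[OF x y] by (simp add: abs_mult [symmetric] abs_less_iff)
  have "(1 + (x + y) / (1 + x * y)) / (1 - (x + y) / (1 + x * y))
      = ((1 + x * y) + (x + y)) / ((1 + x * y) - (x + y))"
    using xy by (simp add: divide_simps)
  also have "\<dots> = ((1 + x) * (1 + y)) / ((1 - x) * (1 - y))"
    by (simp add: algebra_simps)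
  also have "\<dots> = ((1 + x) / (1 - x)) * ((1 + y) / (1 - y))"
    by simp
  finally have *: "(1 + (x + y) / (1 + x * y)) / (1 - (x + y) / (1 + x * y))
      = ((1 + x) / (1 - x)) * ((1 + y) / (1 - y))" .
  have "0 < (1 + x) / (1 - x)" "0 < (1 + y) / (1 - y)"
    using x y by auto
  then have "ln (((1 + x) / (1 - x)) * ((1 + y) / (1 - y))) = ln ((1 + x) / (1 - x)) + ln ((1 + y) / (1 - y))"
    by (rule ln_mult_pos)
  then show ?thesis
    unfolding artanh_def * by simp
qed

text \<open>The defect of the Moebius image is \<open>(1 - \<bar>a\<bar>\<^sup>2) (1 - \<bar>c\<bar>\<^sup>2) / \<bar>1 + cnj a c\<bar>\<^sup>2\<close>,
  which is smallest when \<open>a\<close> and \<open>c\<close> point in the same direction.\<close>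

lemma norm_add_Moebius_le:
  assumes a: "cmod a < 1" and c: "cmod c < 1"
  shows "cmod ((c + a) / (1 + cnj a * c)) \<le> (cmod a + cmod c) / (1 + cmod a * cmod c)"
proof -
  define r s where "r = cmod a" and "s = cmod c"
  have rs: "0 \<le> r" "r < 1" "0 \<le> s" "s < 1"
    using a c by (auto simp: r_def s_def)
  have lt: "cmod (cnj a * c) < 1"
    using norm_mult_less[of "cnj a" 1 c 1] a c by simp
  have ne: "1 + cnj a * c \<noteq> 0"
    by (metis add_eq_0_iff less_irrefl lt norm_minus_cancel norm_one)
  define d where "d = cmod (1 + cnj a * c)"
  have d0: "0 < d"
    using ne by (simp add: d_def)
  have dle: "d \<le> 1 + r * s"
    unfolding d_def r_def s_def by (metis complex_mod_cnj norm_mult norm_one norm_triangle_ineq)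
  have rs0: "0 < 1 + r * s"
    using rs by (simp add: add_pos_nonneg)
  have key: "(cmod (c + a))\<^sup>2 = d\<^sup>2 - (1 - r\<^sup>2) * (1 - s\<^sup>2)"
    unfolding d_def r_def s_def cmod_power2 by (simp add: algebra_simps power2_eq_square)
  have pos: "0 \<le> (1 - r\<^sup>2) * (1 - s\<^sup>2)"
    using rs by (simp add: power_le_one)
  have "(cmod ((c + a) / (1 + cnj a * c)))\<^sup>2 = (cmod (c + a))\<^sup>2 / d\<^sup>2"
    by (simp add: norm_divide d_def power_divide)
  also have "\<dots> = 1 - (1 - r\<^sup>2) * (1 - s\<^sup>2) / d\<^sup>2"
    using d0 by (simp add: key diff_divide_distrib)
  also have "\<dots> \<le> 1 - (1 - r\<^sup>2) * (1 - s\<^sup>2) / (1 + r * s)\<^sup>2"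
    using pos dle d0 by (intro diff_left_mono divide_left_mono power_mono) auto
  also have "\<dots> = ((1 + r * s)\<^sup>2 - (1 - r\<^sup>2) * (1 - s\<^sup>2)) / (1 + r * s)\<^sup>2"
    using rs0 by (simp add: diff_divide_distrib)
  also have "(1 + r * s)\<^sup>2 - (1 - r\<^sup>2) * (1 - s\<^sup>2) = (r + s)\<^sup>2"
    by (simp add: algebra_simps power2_eq_square)
  finally have "(cmod ((c + a) / (1 + cnj a * c)))\<^sup>2 \<le> ((r + s) / (1 + r * s))\<^sup>2"
    by (simp add: power_divide)
  then have "cmod ((c + a) / (1 + cnj a * c)) \<le> (r + s) / (1 + r * s)"
    by (rule power2_le_imp_le) (use rs rs0 in auto)
  then show ?thesis
    by (simp add: r_def s_def)
qed

lemma poincare_dist_Moebius: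
  "poincare_dist a b = artanh (cmod (Moebius_function 0 a b))"
proof -
  have "(a - b) / (1 - cnj a * b) = - ((b - a) / (1 - cnj a * b))"
    by (metis minus_diff_eq minus_divide_left)
  then show ?thesis
    by (simp only: poincare_dist_def Moebius_function_simple norm_minus_cancel)
qed

text \<open>The triangle inequality for \<open>0\<close>, \<open>a\<close>, \<open>b\<close>: moving \<open>a\<close> to the origin turns \<open>b\<close> into a point \<open>c\<close> of
  modulus \<open>tanh (poincare_dist a b)\<close>, and then \<open>artanh\<close> is additive on the bound for the way back.\<close>

lemma poincare_dist_triangle_0:
  assumes a: "cmod a < 1" and b: "cmod b < 1"
  shows "artanh (cmod b) \<le> artanh (cmod a) + poincare_dist a b"
proof -
  define c where "c = Moebius_function 0 a b"
  have c: "cmod c < 1"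
    using a b by (simp add: c_def Moebius_function_norm_lt_1)
  have "b = Moebius_function 0 (- a) c"
    using a b by (simp add: c_def Moebius_function_compose)
  also have "\<dots> = (c + a) / (1 + cnj a * c)"
    by (simp add: Moebius_function_simple)
  finally have "cmod b \<le> (cmod a + cmod c) / (1 + cmod a * cmod c)"
    using norm_add_Moebius_le[OF a c] by simp
  moreover have "(cmod a + cmod c) / (1 + cmod a * cmod c) < 1"
  proof -
    have "0 < (1 - cmod a) * (1 - cmod c)"
      using a c by simp
    moreover have "0 < 1 + cmod a * cmod c"
      by (simp add: add_pos_nonneg)
    ultimately show ?thesis
      by (simp add: algebra_simps)
  qed
  ultimately have "artanh (cmod b) \<le> artanh ((cmod a + cmod c) / (1 + cmod a * cmod c))"
    by (intro artanh_real_mono) (use norm_ge_zero[of b] in linarith)+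
  also have "\<dots> = artanh (cmod a) + artanh (cmod c)"
    using a c by (intro artanh_real_add) auto
  finally show ?thesis
    by (simp add: poincare_dist_Moebius c_def)
qed

text \<open>The Schwarz lemma for the conjugate of \<open>h\<close> by the disc automorphisms that move \<open>a\<close> and \<open>h a\<close> to
  the origin.\<close>

lemma Schwarz_Pick_poincare:
  assumes h: "h holomorphic_on ball 0 1" and hb: "h ` ball 0 1 \<subseteq> ball 0 1"
    and a: "a \<in> ball 0 1" and b: "b \<in> ball 0 1"
  shows "poincare_dist (h a) (h b) \<le> poincare_dist a b"
proof -
  have a1: "cmod a < 1" and b1: "cmod b < 1"
    using a b by auto
  have h1: "cmod (h z) < 1" if "cmod z < 1" for z
    using hb that by (auto simp: image_subset_iff)
  let ?k = "Moebius_function 0 (h a) \<circ> (h \<circ> Moebius_function 0 (- a))"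
  have M: "Moebius_function 0 (- a) ` ball 0 1 \<subseteq> ball 0 1"
    using a1 Moebius_function_norm_lt_1[of "- a"] by auto
  have "?k holomorphic_on ball 0 1"
    using a1 h1 M hb
    by (intro holomorphic_on_compose_gen[OF _ Moebius_function_holomorphic]
        holomorphic_on_compose_gen[OF Moebius_function_holomorphic h]) auto
  moreover have "?k 0 = 0"
    by (simp add: Moebius_function_simple)
  moreover have "cmod (?k z) < 1" if "cmod z < 1" for z
    using that a1 by (simp add: Moebius_function_norm_lt_1 h1)
  moreover have mlt: "cmod (Moebius_function 0 a b) < 1"
    using a1 b1 by (rule Moebius_function_norm_lt_1)
  ultimately have "cmod (?k (Moebius_function 0 a b)) \<le> cmod (Moebius_function 0 a b)"
    by (rule Schwarz_Lemma(1))
  then have "cmod (Moebius_function 0 (h a) (h b)) \<le> cmod (Moebius_function 0 a b)"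
    using a1 b1 by (simp add: Moebius_function_compose)
  then show ?thesis
    unfolding poincare_dist_Moebius using mlt
    by (intro artanh_real_mono) (use norm_ge_zero[of "Moebius_function 0 (h a) (h b)"] in linarith)+
qed

text \<open>Along a chain of discs the images under \<open>\<phi>\<close> move, by Schwarz-Pick, no further than the parameters
  do. As \<open>\<phi> p\<close> is the centre of the disc, the triangle inequality is needed only for triangles with a vertex at
  the origin. Composability with discs is all that is assumed of \<open>\<phi>\<close>, so no notion of holomorphy in two
  variables enters.\<close>

lemma kobayashi_dist_ge_of_disc_map:
  assumes hol: "\<And>f. holomorphic_disc X f \<Longrightarrow> (\<phi> \<circ> f) holomorphic_on ball 0 1"
    and disc: "\<phi> ` X \<subseteq> ball 0 1"
    and p: "\<phi> p = 0"
  shows "kobayashi_dist X p q \<ge> ereal (artanh (cmod (\<phi> q)))"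
  unfolding kobayashi_dist_def
proof (rule Inf_greatest, clarify)
  fix k :: nat and x f a b
  assume "1 \<le> k" and x0: "p = x 0" and xk: "q = x k"
    and ch: "\<forall>i<k. holomorphic_disc X (f i) \<and> a i \<in> ball 0 1 \<and> b i \<in> ball 0 1 \<and>
                f i (a i) = x i \<and> f i (b i) = x (Suc i)"
  have "j \<le> k \<Longrightarrow> cmod (\<phi> (x j)) < 1 \<and> artanh (cmod (\<phi> (x j))) \<le> (\<Sum>i<j. poincare_dist (a i) (b i))" for j
  proof (induction j)
    case 0
    show ?case
      using p x0 by simp
  next
    case (Suc j)
    then have IH: "cmod (\<phi> (x j)) < 1"
        "artanh (cmod (\<phi> (x j))) \<le> (\<Sum>i<j. poincare_dist (a i) (b i))"
      and c: "holomorphic_disc X (f j)" "a j \<in> ball 0 1" "b j \<in> ball 0 1"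
        "f j (a j) = x j" "f j (b j) = x (Suc j)"
      using ch by auto
    have sub: "(\<phi> \<circ> f j) ` ball 0 1 \<subseteq> ball 0 1"
      using c(1) disc unfolding holomorphic_disc_def by (auto simp: image_subset_iff)
    then have lt: "cmod (\<phi> (x (Suc j))) < 1"
      using c(3,5) by (force simp: image_subset_iff)
    have "poincare_dist (\<phi> (x j)) (\<phi> (x (Suc j))) \<le> poincare_dist (a j) (b j)"
      using Schwarz_Pick_poincare[OF hol[OF c(1)] sub c(2,3)] c(4,5) by simp
    then have "artanh (cmod (\<phi> (x (Suc j)))) \<le> artanh (cmod (\<phi> (x j))) + poincare_dist (a j) (b j)"
      using poincare_dist_triangle_0[OF IH(1) lt] by linarith
    then show ?case
      using IH(2) lt by simp
  qed
  then show "ereal (artanh (cmod (\<phi> (x k)))) \<le> ereal (\<Sum>i<k. poincare_dist (a i) (b i))"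
    by simp
qed

section \<open>Attracting basins and proper open maps\<close>

lemma open_attracting_basin: "open (attracting_basin f p)"
proof (subst open_subopen, intro ballI)
  fix x assume "x \<in> attracting_basin f p"
  then obtain U where "open U" "x \<in> U" "uniform_limit U (\<lambda>n. f ^^ n) (\<lambda>_. p) sequentially"
    by (auto simp: attracting_basin_def)
  then show "\<exists>T. open T \<and> x \<in> T \<and> T \<subseteq> attracting_basin f p"
    by (auto simp: attracting_basin_def)
qed

lemma attracting_basin_tendsto:
  assumes "x \<in> attracting_basin f p"
  shows "(\<lambda>n. (f ^^ n) x) \<longlonglongrightarrow> p"
  using assms by (auto simp: attracting_basin_def intro: tendsto_uniform_limitI)

lemma attracting_basin_vimage:
  assumes f: "continuous_on UNIV f" and x: "f x \<in> attracting_basin f p"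
  shows "x \<in> attracting_basin f p"
proof -
  from x obtain U where U: "open U" "f x \<in> U" "uniform_limit U (\<lambda>n. f ^^ n) (\<lambda>_. p) sequentially"
    by (auto simp: attracting_basin_def)
  have "uniform_limit (f -` U) (\<lambda>n. f ^^ n) (\<lambda>_. p) sequentially"
  proof (rule uniform_limitI)
    fix e :: real assume "0 < e"
    then have "\<forall>\<^sub>F n in sequentially. \<forall>y\<in>U. dist ((f ^^ n) y) p < e"
      using uniform_limitD[OF U(3)] by simp
    then have "\<forall>\<^sub>F n in sequentially. \<forall>y\<in>f -` U. dist ((f ^^ Suc n) y) p < e"
      by eventually_elim (auto simp: funpow_swap1)
    then show "\<forall>\<^sub>F n in sequentially. \<forall>y\<in>f -` U. dist ((f ^^ n) y) p < e"
      by (subst (asm) eventually_sequentially_Suc)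
  qed
  moreover have "open (f -` U)"
    using f U(1) by (simp add: open_vimage)
  ultimately show ?thesis
    using U(2) by (auto simp: attracting_basin_def)
qed

lemma attracting_basin_vimage_funpow:
  assumes "continuous_on UNIV f" and "(f ^^ n) x \<in> attracting_basin f p"
  shows "x \<in> attracting_basin f p"
  using assms(2)
proof (induction n arbitrary: x)
  case (Suc n)
  then show ?case
    using attracting_basin_vimage[OF assms(1)] by (metis funpow_swap1 comp_apply funpow.simps(2))
qed simp

text \<open>Openness of \<open>f\<close> turns the neighbourhood of uniform convergence around \<open>x\<close> into one around \<open>f x\<close>.\<close>

lemma attracting_basin_image:
  assumes f: "\<And>U. open U \<Longrightarrow> open (f ` U)" and x: "x \<in> attracting_basin f p"
  shows "f x \<in> attracting_basin f p"
proof -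
  from x obtain U where U: "open U" "x \<in> U" "uniform_limit U (\<lambda>n. f ^^ n) (\<lambda>_. p) sequentially"
    by (auto simp: attracting_basin_def)
  have "uniform_limit (f ` U) (\<lambda>n. f ^^ n) (\<lambda>_. p) sequentially"
  proof (rule uniform_limitI)
    fix e :: real assume "0 < e"
    then have "\<forall>\<^sub>F n in sequentially. \<forall>y\<in>U. dist ((f ^^ n) y) p < e"
      using uniform_limitD[OF U(3)] by simp
    then have "\<forall>\<^sub>F n in sequentially. \<forall>y\<in>U. dist ((f ^^ Suc n) y) p < e"
      by (subst eventually_sequentially_Suc)
    then show "\<forall>\<^sub>F n in sequentially. \<forall>y\<in>f ` U. dist ((f ^^ n) y) p < e"
      by eventually_elim (auto simp: funpow_swap1)
  qed
  then show ?thesis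
    using U f by (auto simp: attracting_basin_def)
qed

lemma attracting_basin_image_funpow:
  assumes "\<And>U. open U \<Longrightarrow> open (f ` U)" and "x \<in> attracting_basin f p"
  shows "(f ^^ n) x \<in> attracting_basin f p"
  by (induction n) (simp_all add: assms attracting_basin_image)

text \<open>The image of a component is open because \<open>f\<close> is open, and relatively closed in \<open>S\<close> because \<open>f\<close> is proper: a
  limit in \<open>S\<close> of image points lifts to a limit point of \<open>C\<close>, which lies in \<open>S\<close> and hence in \<open>C\<close>. A nonempty
  connected subset with both properties is a component.\<close>

lemma image_component_proper_open:
  fixes f :: "'a::euclidean_space \<Rightarrow> 'a"
  assumes cont: "continuous_on UNIV f"
    and opn: "\<And>U. open U \<Longrightarrow> open (f ` U)"
    and proper: "\<And>R. \<exists>R'. \<forall>x. norm (f x) \<le> R \<longrightarrow> norm x \<le> R'"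
    and inv: "f -` S = S" and S: "open S"
    and C: "C \<in> components S"
  shows "f ` C \<in> components S"
proof -
  have Cop: "open C" and CS: "C \<subseteq> S" and Cconn: "connected C" and Cne: "C \<noteq> {}"
    using C S open_components[OF S C] in_components_subset[OF C] in_components_connected[OF C]
      in_components_nonempty[OF C] by auto
  have fCS: "f ` C \<subseteq> S"
    using CS inv by auto
  have fCconn: "connected (f ` C)"
    using Cconn cont continuous_on_subset connected_continuous_image by blast
  have limit: "y \<in> f ` C" if y: "y \<in> S" "y \<in> closure (f ` C)" for y
  proof -
    obtain s where s: "\<And>n. s n \<in> f ` C" "s \<longlonglongrightarrow> y"
      using y(2) by (auto simp: closure_sequential)
    then have "\<forall>n. \<exists>c. c \<in> C \<and> s n = f c"
      by blast
    then obtain x where x: "\<And>n. x n \<in> C" "\<And>n. s n = f (x n)"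
      by metis
    obtain R where R: "\<And>n. norm (s n) \<le> R"
      using convergent_imp_bounded[OF s(2)] unfolding bounded_iff by blast
    obtain R' where "\<forall>x. norm (f x) \<le> R \<longrightarrow> norm x \<le> R'"
      using proper by blast
    then have "\<And>n. x n \<in> cball 0 R'"
      using R x(2) by simp
    then obtain l r where lr: "strict_mono (r :: nat \<Rightarrow> nat)" "(x \<circ> r) \<longlonglongrightarrow> l"
      using compact_cball[of 0 R'] unfolding compact_def by blast
    have "(\<lambda>n. f ((x \<circ> r) n)) \<longlonglongrightarrow> f l"
      using continuous_on_tendsto_compose[OF cont lr(2)] by simp
    moreover have "(\<lambda>n. f ((x \<circ> r) n)) \<longlonglongrightarrow> y"
      using LIMSEQ_subseq_LIMSEQ[OF s(2) lr(1)] x(2) by (simp add: o_def)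
    ultimately have fl: "f l = y"
      by (rule LIMSEQ_unique)
    then have "l \<in> S"
      using y(1) inv by blast
    moreover have "l \<in> closure C"
      unfolding closure_sequential
      by (rule exI[of _ "x \<circ> r"]) (use lr(2) x(1) in \<open>simp add: comp_def\<close>)
    ultimately have lS: "insert l C \<subseteq> S" and lcl: "insert l C \<subseteq> closure C"
      using CS closure_subset[of C] by simp_all
    have "connected (insert l C)"
      using connected_intermediate_closure[OF Cconn subset_insertI lcl] .
    then have "insert l C \<subseteq> C"
      using components_maximal[OF C _ lS] Cne by blast
    then show "y \<in> f ` C"
      using fl by blast
  qed
  \<comment> \<open>A larger connected set would be split by the image and the complement of its closure.\<close>
  have maximal: "T \<subseteq> f ` C" if T: "connected T" "T \<subseteq> S" "f ` C \<subseteq> T" for T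
  proof (rule ccontr)
    assume "\<not> T \<subseteq> f ` C"
    then obtain y where "y \<in> T" "y \<notin> closure (f ` C)"
      using limit T(2) by blast
    then have "- closure (f ` C) \<inter> T \<noteq> {}"
      by blast
    moreover have "f ` C \<inter> T \<noteq> {}"
      using T(3) Cne by blast
    moreover have "T \<subseteq> f ` C \<union> - closure (f ` C)"
      using limit T(2) by blast
    moreover have "f ` C \<inter> - closure (f ` C) \<inter> T = {}"
      using closure_subset[of "f ` C"] by blast
    ultimately show False
      using connectedD[OF T(1) opn[OF Cop], of "- closure (f ` C)"] by auto
  qed
  show ?thesis
    unfolding in_components_maximal using Cne fCS fCconn maximal by blast
qed

lemma image_component_funpow_proper_open:
  fixes f :: "'a::euclidean_space \<Rightarrow> 'a"
  assumes "continuous_on UNIV f" "\<And>U. open U \<Longrightarrow> open (f ` U)"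
    "\<And>R. \<exists>R'. \<forall>x. norm (f x) \<le> R \<longrightarrow> norm x \<le> R'"
    and "C \<in> components (attracting_basin f p)"
  shows "(f ^^ n) ` C \<in> components (attracting_basin f p)"
proof (induction n)
  case (Suc n)
  have "f -` attracting_basin f p = attracting_basin f p"
    using attracting_basin_vimage[OF assms(1)] attracting_basin_image[of f, OF assms(2)] by blast
  then have "f ` (f ^^ n) ` C \<in> components (attracting_basin f p)"
    by (intro image_component_proper_open assms Suc.IH open_attracting_basin)
  then show ?case
    by (simp add: image_comp)
qed (use assms in simp)

section \<open>The parabolic polynomial near its fixed point\<close>

definition base_map :: "complex \<Rightarrow> complex" where
  "base_map z = z - z\<^sup>2"

text \<open>Superlevel sets of this height in the coordinate \<open>u = 1 / z\<close> are sectors around the positive real axis, so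
  unlike a half-plane \<open>Re u > r\<close> they bound \<open>\<bar>z\<bar>\<close> by a multiple of \<open>Re z\<close>. At \<open>z = 0\<close> the height is \<open>0\<close>.\<close>

definition petal_height :: "complex \<Rightarrow> real" where
  "petal_height z = Re (1 / z) - \<bar>Im (1 / z)\<bar>"

definition petal :: "complex set" where
  "petal = {z. 5 < petal_height z}"

lemma base_map_holomorphic: "base_map holomorphic_on A"
  unfolding base_map_def by (intro holomorphic_intros)

lemma continuous_on_base_map: "continuous_on A base_map"
  using base_map_holomorphic holomorphic_on_imp_continuous_on by blast

lemma open_image_entire:
  assumes "f holomorphic_on UNIV" "f p \<noteq> f q" "open U"
  shows "open (f ` U)"
proof (rule open_mapping_thm[of f UNIV])
  show "\<not> f constant_on UNIV"
    using assms(2) by (metis UNIV_I constant_on_def)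
qed (use assms in auto)

lemma open_image_base_map:
  assumes "open U"
  shows "open (base_map ` U)"
  using base_map_holomorphic _ assms by (rule open_image_entire[of _ 0 2]) (simp add: base_map_def)

lemma base_map_proper: "\<exists>R'. \<forall>z. norm (base_map z) \<le> R \<longrightarrow> norm z \<le> R'"
proof (intro exI allI impI)
  fix z assume le: "norm (base_map z) \<le> R"
  have "norm z * norm z = norm (z - base_map z)"
    by (simp add: base_map_def power2_eq_square norm_mult)
  also have "\<dots> \<le> norm z + R"
    using norm_triangle_ineq4[of z "base_map z"] le by linarith
  finally have sq: "norm z * norm z \<le> norm z + R" .
  have R: "0 \<le> R"
    using le norm_ge_zero order_trans by blast
  show "norm z \<le> 2 + R"
  proof (rule ccontr)
    assume "\<not> norm z \<le> 2 + R"
    then have z: "2 + R < norm z" by simp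
    then have "2 * norm z \<le> norm z * norm z"
      using R by (intro mult_right_mono) auto
    then show False
      using sq z R by linarith
  qed
qed

text \<open>In the coordinate \<open>u = 1 / z\<close> the polynomial is a perturbed unit translation.\<close>

lemma recip_base_map:
  assumes "z \<noteq> 0" "z \<noteq> 1"
  shows "1 / base_map z = 1 / z + 1 + 1 / (1 / z - 1)"
proof -
  have "base_map z = z * (1 - z)"
    by (simp add: base_map_def power2_eq_square algebra_simps)
  moreover have "1 / z - 1 = (1 - z) / z" "1 - z \<noteq> 0"
    using assms by (simp_all add: diff_divide_distrib)
  ultimately show ?thesis
    using assms by (simp add: divide_simps) (simp add: algebra_simps)
qed

text \<open>For \<open>\<bar>u\<bar> \<ge> 5\<close> the perturbation \<open>1 / (u - 1)\<close> of the translation has modulus at most \<open>1/4\<close>, so \<open>Re u\<close> gains at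
  least \<open>3/4\<close> and \<open>\<bar>Im u\<bar>\<close> at most \<open>1/4\<close>.\<close>

lemma petal_height_step:
  assumes z: "z \<noteq> 0" "cmod z \<le> 1/5"
  shows "petal_height (base_map z) \<ge> petal_height z + 1/2"
proof -
  define u where "u = 1 / z"
  have z1: "z \<noteq> 1"
    using z by auto
  have "5 \<le> cmod u"
    using z by (simp add: u_def norm_divide field_simps)
  then have "4 \<le> cmod (u - 1)"
    using norm_triangle_ineq2[of u 1] by simp
  then have n: "cmod (1 / (u - 1)) \<le> 1/4"
    by (simp add: norm_divide divide_simps)
  have r: "\<bar>Re (1 / (u - 1))\<bar> \<le> 1/4" and i: "\<bar>Im (1 / (u - 1))\<bar> \<le> 1/4"
    using abs_Re_le_cmod[of "1 / (u - 1)"] abs_Im_le_cmod[of "1 / (u - 1)"] n by linarith+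
  have e: "1 / base_map z = u + 1 + 1 / (u - 1)"
    unfolding u_def by (rule recip_base_map[OF z(1) z1])
  show ?thesis
    unfolding petal_height_def e u_def[symmetric] plus_complex.simps one_complex.simps
    using r i by linarith
qed

lemma petal_nonzero: "z \<in> petal \<Longrightarrow> z \<noteq> 0"
  by (auto simp: petal_def petal_height_def)

lemma norm_le_of_petal_height:
  assumes "0 < h" "h \<le> petal_height z"
  shows "cmod z \<le> 1 / h"
proof -
  have "h \<le> cmod (1 / z)"
    using assms complex_Re_le_cmod[of "1 / z"] unfolding petal_height_def by linarith
  moreover have "z \<noteq> 0"
    using assms by (auto simp: petal_height_def)
  ultimately show ?thesis
    using assms by (simp add: norm_divide field_simps)
qed

lemma petal_norm_le: "z \<in> petal \<Longrightarrow> cmod z \<le> 1/5"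
  by (rule norm_le_of_petal_height) (auto simp: petal_def)

lemma base_map_in_petal: "z \<in> petal \<Longrightarrow> base_map z \<in> petal"
  using petal_height_step[OF petal_nonzero petal_norm_le, of z] by (simp add: petal_def)

lemma funpow_base_map_in_petal: "z \<in> petal \<Longrightarrow> (base_map ^^ n) z \<in> petal"
  by (induction n) (simp_all add: base_map_in_petal)

lemma petal_height_funpow:
  assumes "z \<in> petal"
  shows "petal_height ((base_map ^^ n) z) \<ge> 5 + n / 2"
proof (induction n)
  case (Suc n)
  have "(base_map ^^ n) z \<in> petal"
    using assms by (rule funpow_base_map_in_petal)
  from petal_height_step[OF petal_nonzero petal_norm_le, OF this this] Suc
  show ?case
    by (simp add: add_divide_distrib)
qed (use assms in \<open>simp add: petal_def\<close>)

text \<open>Once the orbit stays in the disc \<open>\<bar>z\<bar> \<le> 1/5\<close>, its height grows linearly whatever it was before.\<close>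

lemma eventually_in_petal:
  assumes lim: "(\<lambda>n. (base_map ^^ n) z) \<longlonglongrightarrow> 0" and ne: "\<And>n. (base_map ^^ n) z \<noteq> 0"
  shows "\<exists>n. (base_map ^^ n) z \<in> petal"
proof -
  have "\<forall>\<^sub>F n in sequentially. dist ((base_map ^^ n) z) 0 < 1/5"
    using lim by (rule tendstoD) simp
  then obtain N where N: "\<And>n. N \<le> n \<Longrightarrow> cmod ((base_map ^^ n) z) < 1/5"
    by (auto simp: eventually_sequentially)
  have h: "petal_height ((base_map ^^ (N + k)) z) \<ge> petal_height ((base_map ^^ N) z) + k / 2" for k
  proof (induction k)
    case (Suc k)
    have "petal_height (base_map ((base_map ^^ (N + k)) z)) \<ge> petal_height ((base_map ^^ (N + k)) z) + 1/2"
      using N[of "N + k"] by (intro petal_height_step ne) simp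
    then show ?case
      using Suc by (simp add: add_divide_distrib)
  qed simp
  obtain k :: nat where "5 - petal_height ((base_map ^^ N) z) < k / 2"
    using reals_Archimedean2[of "2 * (5 - petal_height ((base_map ^^ N) z))"] by (auto simp: field_simps)
  with h[of k] show ?thesis
    by (intro exI[of _ "N + k"]) (simp add: petal_def)
qed

text \<open>A forward invariant part of the half-plane \<open>Im u > 2\<close>. In one step \<open>Im u\<close> shrinks by the factor
  \<open>1 - 1 / \<bar>u - 1\<bar>\<^sup>2\<close>, while \<open>x = Re u - 1\<close> advances by at least \<open>1/2\<close>; so the total loss of \<open>ln (Im u)\<close> is
  dominated by the integral of a multiple of \<open>1 / (1 + x\<^sup>2)\<close>, for which the arctangent term compensates. As
  \<open>8 arctan x < 4 pi\<close>, the threshold forces \<open>Im u > 2\<close>.\<close>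

definition upper_tract :: "complex set" where
  "upper_tract = {z. 0 < Im (1 / z) \<and>
     ln 2 + 4 * pi < ln (Im (1 / z)) + 8 * arctan (Re (1 / z) - 1)}"

lemma upper_tract_Im:
  assumes "z \<in> upper_tract"
  shows "2 < Im (1 / z)"
proof -
  have "arctan (Re (1 / z) - 1) < pi / 2"
    by (rule arctan_ubound)
  then have "ln 2 < ln (Im (1 / z))"
    using assms unfolding upper_tract_def mem_Collect_eq by linarith
  then show ?thesis
    using assms by (simp add: upper_tract_def)
qed

text \<open>The factor \<open>exp (8 pi)\<close> absorbs the full oscillation of \<open>8 arctan\<close>.\<close>

definition tract_height :: real where
  "tract_height = 2 * exp (8 * pi)"

lemma tract_height_pos: "0 < tract_height"
  by (simp add: tract_height_def)

lemma in_upper_tract: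
  assumes "tract_height < Im (1 / z)"
  shows "z \<in> upper_tract"
proof -
  have pos: "0 < Im (1 / z)"
    using assms tract_height_pos by linarith
  have "ln tract_height < ln (Im (1 / z))"
    using assms pos tract_height_pos by simp
  then have "ln 2 + 8 * pi < ln (Im (1 / z))"
    by (simp add: tract_height_def ln_mult)
  moreover have "- (pi / 2) < arctan (Re (1 / z) - 1)"
    by (rule arctan_lbound)
  ultimately show ?thesis
    using pos by (simp add: upper_tract_def)
qed

text \<open>The mean value theorem on the interval from \<open>x\<close> to \<open>x + 1/2\<close>, with
  \<open>1 + \<xi>\<^sup>2 \<le> 2 (x\<^sup>2 + 1)\<close> there.\<close>

lemma arctan_increment:
  fixes x x' :: real
  assumes "x + 1/2 \<le> x'"
  shows "arctan x' - arctan x \<ge> 1 / (4 * (x\<^sup>2 + 1))"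
proof -
  have "\<exists>\<xi>. x < \<xi> \<and> \<xi> < x + 1/2 \<and> arctan (x + 1/2) - arctan x = (x + 1/2 - x) * inverse (1 + \<xi>\<^sup>2)"
    by (rule MVT2) (auto intro!: DERIV_arctan)
  then obtain \<xi> where \<xi>: "x < \<xi>" "\<xi> < x + 1/2"
      "arctan (x + 1/2) - arctan x = 1/2 * inverse (1 + \<xi>\<^sup>2)"
    by auto
  have "\<xi>\<^sup>2 \<le> (\<bar>x\<bar> + 1/2)\<^sup>2"
    using \<xi> by (intro power2_le_iff_abs_le[THEN iffD2]) auto
  also have "\<dots> \<le> 2 * x\<^sup>2 + 1"
    using zero_le_power2[of "\<bar>x\<bar> - 1/2"] by (simp add: power2_eq_square algebra_simps)
  finally have "1 + \<xi>\<^sup>2 \<le> 2 * (x\<^sup>2 + 1)"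
    by simp
  then have "inverse (2 * (x\<^sup>2 + 1)) \<le> inverse (1 + \<xi>\<^sup>2)"
    by (intro le_imp_inverse_le) (auto intro: add_pos_nonneg)
  moreover have "arctan (x + 1/2) \<le> arctan x'"
    using assms by (simp add: arctan_monotone')
  moreover have "1/2 * inverse (2 * (x\<^sup>2 + 1)) = 1 / (4 * (x\<^sup>2 + 1))"
    by (simp add: inverse_eq_divide)
  ultimately show ?thesis
    using \<xi>(3) by linarith
qed

lemma upper_tract_step:
  assumes z: "z \<in> upper_tract"
  shows "base_map z \<in> upper_tract"
    and "Im (1 / base_map z) \<le> Im (1 / z)"
    and "Re (1 / z) + 1/2 \<le> Re (1 / base_map z)"
proof -
  define t where "t = 1 / z - 1"
  define x y where "x = Re t" and "y = Im t"
  have y: "2 < y"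
    using upper_tract_Im[OF z] by (simp add: y_def t_def)
  have z0: "z \<noteq> 0" and z1: "z \<noteq> 1"
    using y by (auto simp: y_def t_def)
  define q where "q = x\<^sup>2 + y\<^sup>2"
  have "2\<^sup>2 \<le> y\<^sup>2"
    using y by (intro power_mono) auto
  then have q: "4 \<le> q" "x\<^sup>2 + 1 \<le> q"
    by (auto simp: q_def intro: add_increasing)
  have e: "1 / base_map z = t + 2 + 1 / t"
    using recip_base_map[OF z0 z1] by (simp add: t_def)
  have ut: "1 / z = t + 1"
    by (simp add: t_def)
  have Ree: "Re (1 / base_map z) = x + 2 + x / q"
    unfolding e by (simp add: x_def y_def q_def Re_divide power2_eq_square)
  have Ime: "Im (1 / base_map z) = y - y / q"
    unfolding e by (simp add: x_def y_def q_def Im_divide power2_eq_square)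
  have "\<bar>x\<bar> \<le> q / 2"
  proof -
    have "0 \<le> (\<bar>x\<bar> - 1)\<^sup>2"
      by simp
    then have "2 * \<bar>x\<bar> \<le> x\<^sup>2 + 1"
      by (simp add: power2_eq_square algebra_simps)
    then show ?thesis
      using q by simp
  qed
  then have xq: "\<bar>x / q\<bar> \<le> 1/2"
    using q by (simp add: field_simps)
  show "Re (1 / z) + 1/2 \<le> Re (1 / base_map z)"
    using xq unfolding Ree ut x_def[symmetric] plus_complex.simps one_complex.simps by linarith
  show "Im (1 / base_map z) \<le> Im (1 / z)"
    using y q unfolding Ime ut by (simp add: y_def)
  have q14: "1 / q \<le> 1/4"
    using q by (simp add: field_simps)
  have fac: "y - y / q = y * (1 - 1 / q)"
    by (simp add: algebra_simps)
  \<comment> \<open>The loss of the logarithm is at most \<open>2 / q\<close>, the gain of \<open>8 arctan\<close> at least that.\<close>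
  have "ln (1 - 1 / q) \<ge> - (1 / q) - 2 * (1 / q)\<^sup>2"
    using q14 q by (intro ln_one_minus_pos_lower_bound) auto
  moreover have "2 * (1 / q)\<^sup>2 \<le> 1 / q"
    using q by (simp add: power2_eq_square field_simps)
  ultimately have lnq: "ln (1 - 1 / q) \<ge> - 2 / q"
    by simp
  have "arctan (x + 1 + x / q) - arctan x \<ge> 1 / (4 * (x\<^sup>2 + 1))"
    using xq by (intro arctan_increment) linarith
  moreover have "1 / (4 * q) \<le> 1 / (4 * (x\<^sup>2 + 1))"
    using q by (intro divide_left_mono) (auto intro!: mult_pos_pos add_nonneg_pos)
  ultimately have "8 * arctan (x + 1 + x / q) - 8 * arctan x \<ge> 2 / q"
    by simp
  moreover have "ln (y - y / q) = ln y + ln (1 - 1 / q)"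
    unfolding fac using y q14 by (intro ln_mult_pos) auto
  ultimately have "ln y + 8 * arctan x \<le> ln (y - y / q) + 8 * arctan (x + 1 + x / q)"
    using lnq by simp
  moreover have "ln 2 + 4 * pi < ln y + 8 * arctan x"
    using z by (simp add: upper_tract_def x_def y_def t_def)
  moreover have "0 < y - y / q"
    unfolding fac using y q14 by (intro mult_pos_pos) auto
  moreover have "x + 2 + x / q - 1 = x + 1 + x / q"
    by simp
  ultimately show "base_map z \<in> upper_tract"
    unfolding upper_tract_def mem_Collect_eq Ree Ime by (metis less_le_trans)
qed

lemma funpow_upper_tract: "z \<in> upper_tract \<Longrightarrow> (base_map ^^ n) z \<in> upper_tract"
  by (induction n) (simp_all add: upper_tract_step(1))

text \<open>The real part of \<open>u\<close> tends to infinity while its imaginary part stays positive and does not grow.\<close>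

lemma upper_tract_enters_petal:
  assumes z: "z \<in> upper_tract"
  shows "\<exists>n. (base_map ^^ n) z \<in> petal"
proof -
  have h: "Re (1 / (base_map ^^ n) z) \<ge> Re (1 / z) + n / 2 \<and> Im (1 / (base_map ^^ n) z) \<le> Im (1 / z)" for n
  proof (induction n)
    case (Suc n)
    have "(base_map ^^ n) z \<in> upper_tract"
      using z by (rule funpow_upper_tract)
    from upper_tract_step(2,3)[OF this] Suc show ?case
      by (simp add: add_divide_distrib)
  qed simp
  obtain n :: nat where n: "2 * (5 - (Re (1 / z) - Im (1 / z))) < n"
    using reals_Archimedean2 by blast
  have "2 < Im (1 / (base_map ^^ n) z)"
    using z funpow_upper_tract upper_tract_Im by blast
  then have "\<bar>Im (1 / (base_map ^^ n) z)\<bar> = Im (1 / (base_map ^^ n) z)"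
    by (intro abs_of_pos) linarith
  moreover have lin: "5 < R - I" if "X + m / 2 \<le> R" "I \<le> Y" "2 * (5 - (X - Y)) < m" for X Y R I m :: real
    using that by argo
  ultimately have "5 < petal_height ((base_map ^^ n) z)"
    using lin[OF conjunct1[OF h[of n]] conjunct2[OF h[of n]] n] by (simp only: petal_height_def)
  then show ?thesis
    by (auto simp: petal_def)
qed

lemma base_map_cnj: "base_map (cnj z) = cnj (base_map z)"
  by (simp add: base_map_def)

lemma funpow_base_map_cnj: "(base_map ^^ n) (cnj z) = cnj ((base_map ^^ n) z)"
  by (induction n) (simp_all add: base_map_cnj)

text \<open>Above \<open>tract_height\<close> the whole orbit has \<open>Im (1 / z) > 2\<close> and cannot meet the real axis; by complex
  conjugation the same holds below \<open>- tract_height\<close>. This confines the grand orbit of any real point.\<close>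

lemma Im_recip_le_of_real_orbit:
  assumes real: "(base_map ^^ m) z \<in> \<real>"
  shows "\<bar>Im (1 / z)\<bar> \<le> tract_height"
proof -
  have up: "Im (1 / y) \<le> tract_height" if y: "(base_map ^^ m) y \<in> \<real>" for y
  proof (rule ccontr)
    assume "\<not> ?thesis"
    then have "(base_map ^^ m) y \<in> upper_tract"
      by (intro funpow_upper_tract in_upper_tract) simp
    then have "2 < Im (1 / (base_map ^^ m) y)"
      by (rule upper_tract_Im)
    moreover have "1 / (base_map ^^ m) y \<in> \<real>"
      using y by (intro Reals_divide) auto
    ultimately show False
      by (simp add: complex_is_Real_iff)
  qed
  have "(base_map ^^ m) (cnj z) \<in> \<real>"
    using real by (simp add: funpow_base_map_cnj complex_is_Real_iff)
  from up[OF this] have "Im (cnj (1 / z)) \<le> tract_height"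
    by simp
  then show ?thesis
    using up[OF real] unfolding cnj.simps by linarith
qed

section \<open>The slit plane\<close>

lemma base_map_neg_orbit:
  assumes "x < 0"
  shows "\<exists>y. y \<le> x \<and> (base_map ^^ n) (of_real x) = of_real y"
proof (induction n)
  case (Suc n)
  then obtain y where y: "y \<le> x" "(base_map ^^ n) (of_real x) = of_real y"
    by blast
  have "(base_map ^^ Suc n) (of_real x) = of_real (y - y\<^sup>2)"
    using y(2) by (simp add: base_map_def)
  moreover have "y - y\<^sup>2 \<le> x"
    using y(1) zero_le_power2[of y] by linarith
  ultimately show ?case
    by blast
qed auto

abbreviation base_basin :: "complex set" where
  "base_basin \<equiv> attracting_basin base_map 0"

lemma neg_notin_base_basin:
  assumes "x < 0"
  shows "of_real x \<notin> base_basin"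
proof
  assume "of_real x \<in> base_basin"
  then have "\<forall>\<^sub>F n in sequentially. dist ((base_map ^^ n) (of_real x)) 0 < - x"
    using assms by (intro tendstoD attracting_basin_tendsto) auto
  then obtain n where "cmod ((base_map ^^ n) (of_real x)) < - x"
    by (auto simp: eventually_sequentially)
  moreover obtain y where "y \<le> x" "(base_map ^^ n) (of_real x) = of_real y"
    using base_map_neg_orbit[OF assms] by blast
  ultimately show False
    by simp
qed

lemma funpow_in_base_basin: "z \<in> base_basin \<Longrightarrow> (base_map ^^ n) z \<in> base_basin"
  by (rule attracting_basin_image_funpow) (simp_all add: open_image_base_map)

text \<open>A point of the basin comes with a neighbourhood, so the boundary case \<open>x = 0\<close>, whose orbit does
  converge to \<open>0\<close>, follows from nearby negative points.\<close>

lemma nonpos_notin_base_basin: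
  assumes "x \<le> 0"
  shows "of_real x \<notin> base_basin"
proof
  assume *: "of_real x \<in> base_basin"
  then obtain e where e: "0 < e" "ball (of_real x) e \<subseteq> base_basin"
    using open_attracting_basin[of base_map 0] by (auto simp: open_contains_ball)
  have "complex_of_real (x - e/2) \<in> ball (of_real x) e"
    using e(1) by (simp add: dist_norm)
  moreover have "complex_of_real (x - e/2) \<notin> base_basin"
    using assms e(1) by (intro neg_notin_base_basin) simp
  ultimately show False
    using e(2) by blast
qed

lemma base_basin_enters_petal:
  assumes "z \<in> base_basin"
  shows "\<exists>n. (base_map ^^ n) z \<in> petal"
proof (rule eventually_in_petal)
  show "(base_map ^^ n) z \<noteq> 0" for n
    using funpow_in_base_basin[OF assms, of n] nonpos_notin_base_basin[of 0] by auto
qed (rule attracting_basin_tendsto[OF assms])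

text \<open>The condition \<open>1 / z - 1 \<le> 0\<close> describes the real \<open>z\<close> with \<open>z \<le> 0\<close> or \<open>z \<ge> 1\<close>; the
  latter are mapped by one step to the former.\<close>

lemma base_basin_slit:
  assumes "z \<in> base_basin"
  shows "1 / z - 1 \<notin> \<real>\<^sub>\<le>\<^sub>0"
proof
  assume "1 / z - 1 \<in> \<real>\<^sub>\<le>\<^sub>0"
  then obtain s where s: "1 / z - 1 = of_real s" "s \<le> 0"
    by (auto elim: nonpos_Reals_cases)
  then have "1 / z = of_real (1 + s)"
    by (simp add: algebra_simps)
  then have z: "z = of_real (1 / (1 + s))"
    by (metis divide_divide_eq_right div_by_1 mult_1 of_real_1 of_real_divide)
  show False
  proof (cases "1 + s \<le> 0")
    case True
    then show False
      using assms nonpos_notin_base_basin[of "1 / (1 + s)"] z by simp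
  next
    case False
    define r where "r = 1 / (1 + s)"
    have "1 \<le> r"
      using False s by (simp add: r_def)
    then have "r \<le> r\<^sup>2"
      by (simp add: self_le_power)
    then have "of_real (r - r\<^sup>2) \<notin> base_basin"
      by (intro nonpos_notin_base_basin) simp
    moreover have "base_map z = of_real (r - r\<^sup>2)"
      using z by (simp add: base_map_def r_def)
    ultimately show False
      using funpow_in_base_basin[OF assms, of 1] by simp
  qed
qed

lemma Re_csqrt_pos:
  assumes "z \<notin> \<real>\<^sub>\<le>\<^sub>0"
  shows "0 < Re (csqrt z)"
proof (rule ccontr)
  assume "\<not> 0 < Re (csqrt z)"
  then have "Re (csqrt z) = 0"
    using Re_csqrt[of z] by simp
  then have "csqrt z = \<i> * of_real (Im (csqrt z))"
    by (simp add: complex_eq_iff)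
  then have "(csqrt z)\<^sup>2 = - of_real ((Im (csqrt z))\<^sup>2)"
    by (metis mult_minus1 of_real_power power2_i power_mult_distrib)
  then have "z = of_real (- ((Im (csqrt z))\<^sup>2))"
    by simp
  moreover have "complex_of_real (- ((Im (csqrt z))\<^sup>2)) \<in> \<real>\<^sub>\<le>\<^sub>0"
    unfolding nonpos_Reals_of_real_iff by simp
  ultimately show False
    using assms by argo
qed

text \<open>The isometry from the right half-plane to the disc that sends \<open>v\<^sub>1\<close> to the centre.\<close>

definition cayley :: "complex \<Rightarrow> complex \<Rightarrow> complex" where
  "cayley v\<^sub>1 v = (v - v\<^sub>1) / (v + cnj v\<^sub>1)"

lemma cayley_defect:
  assumes "0 < Re v" "0 < Re v\<^sub>1"
  shows "(cmod (cayley v\<^sub>1 v))\<^sup>2 = 1 - 4 * Re v * Re v\<^sub>1 / (cmod (v + cnj v\<^sub>1))\<^sup>2"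
proof -
  have "v + cnj v\<^sub>1 \<noteq> 0"
    using assms by (auto simp: complex_eq_iff)
  moreover have "(cmod (v - v\<^sub>1))\<^sup>2 = (cmod (v + cnj v\<^sub>1))\<^sup>2 - 4 * Re v * Re v\<^sub>1"
    unfolding cmod_power2 by (simp add: power2_eq_square algebra_simps)
  ultimately show ?thesis
    by (simp add: cayley_def norm_divide power_divide) (simp add: diff_divide_distrib)
qed

lemma norm_cayley_less_1:
  assumes "0 < Re v" "0 < Re v\<^sub>1"
  shows "cmod (cayley v\<^sub>1 v) < 1"
proof -
  have "v + cnj v\<^sub>1 \<noteq> 0"
    using assms by (auto simp: complex_eq_iff)
  then have "(cmod (cayley v\<^sub>1 v))\<^sup>2 < 1"
    using assms by (simp add: cayley_defect)
  then show ?thesis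
    by (simp add: power_less_one_iff)
qed

text \<open>With \<open>v = \<alpha> + \<i> \<beta>\<close> the defect is \<open>4 \<alpha> / ((\<alpha> + 1)\<^sup>2 + (\<beta> - t)\<^sup>2)\<close>. It is small if \<open>\<alpha>\<close> is very small or very
  large. In between, the bound \<open>2 \<alpha> \<bar>\<beta>\<bar> \<le> c\<close> keeps \<open>\<beta>\<close> bounded, and it is the large \<open>t\<close> that makes the
  denominator large.\<close>

lemma cayley_far:
  fixes c \<epsilon> :: real and v :: complex
  assumes \<epsilon>: "0 < \<epsilon>" and c: "0 \<le> c" and t: "t = (c + 4) / \<epsilon> * 2"
    and v: "0 < Re v" "\<bar>Im (v\<^sup>2)\<bar> \<le> c"
  shows "1 - \<epsilon> \<le> (cmod (cayley (Complex 1 t) v))\<^sup>2"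
proof -
  define \<alpha> \<beta> where "\<alpha> = Re v" and "\<beta> = Im v"
  define D where "D = (\<alpha> + 1)\<^sup>2 + (\<beta> - t)\<^sup>2"
  have \<alpha>: "0 < \<alpha>"
    using v by (simp add: \<alpha>_def)
  have ab: "2 * (\<alpha> * \<bar>\<beta>\<bar>) \<le> c"
    using v by (simp add: \<alpha>_def \<beta>_def power2_eq_square abs_mult mult.commute)
  have D1: "1 \<le> (\<alpha> + 1)\<^sup>2" and D2: "\<alpha>\<^sup>2 \<le> (\<alpha> + 1)\<^sup>2" and D3: "0 \<le> (\<beta> - t)\<^sup>2"
    using \<alpha> by (auto intro!: one_le_power power_mono)
  have "4 * \<alpha> \<le> \<epsilon> * D"
  proof -
    consider "4 * \<alpha> \<le> \<epsilon>" | "4 \<le> \<epsilon> * \<alpha>" | "\<epsilon> < 4 * \<alpha>" "\<epsilon> * \<alpha> < 4"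
      by linarith
    then show ?thesis
    proof cases
      case 1
      have "\<epsilon> * 1 \<le> \<epsilon> * D"
        using \<epsilon> D1 D3 unfolding D_def by (intro mult_left_mono) linarith+
      then show ?thesis
        using 1 by simp
    next
      case 2
      have "4 * \<alpha> \<le> \<epsilon> * \<alpha> * \<alpha>"
        using 2 \<alpha> by (intro mult_right_mono) auto
      also have "\<dots> = \<epsilon> * \<alpha>\<^sup>2"
        by (simp add: power2_eq_square)
      also have "\<dots> \<le> \<epsilon> * D"
        using \<epsilon> D2 D3 unfolding D_def by (intro mult_left_mono) linarith+
      finally show ?thesis .
    next
      case 3
      have "\<epsilon> * \<bar>\<beta>\<bar> \<le> 4 * \<alpha> * \<bar>\<beta>\<bar>"
        using 3 by (intro mult_right_mono) auto
      then have "\<epsilon> * \<bar>\<beta>\<bar> \<le> 2 * c"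
        using ab by simp
      then have b: "\<bar>\<beta>\<bar> \<le> 2 * c / \<epsilon>"
        using \<epsilon> by (simp add: field_simps)
      have a: "4 * \<alpha> \<le> 16 / \<epsilon>"
        using 3 \<epsilon> by (simp add: field_simps)
      have t': "t = 2 * c / \<epsilon> + 8 / \<epsilon>"
        unfolding t by (simp add: add_divide_distrib algebra_simps)
      have "8 / \<epsilon> \<le> t - \<beta>"
        using b unfolding t' by linarith
      then have "(8 / \<epsilon>)\<^sup>2 \<le> (t - \<beta>)\<^sup>2"
        using \<epsilon> by (intro power_mono) auto
      also have "\<dots> \<le> D"
        by (simp add: D_def power2_commute)
      finally have "\<epsilon> * (8 / \<epsilon>)\<^sup>2 \<le> \<epsilon> * D"
        using \<epsilon> by (intro mult_left_mono) auto
      moreover have "\<epsilon> * (8 / \<epsilon>)\<^sup>2 = 64 / \<epsilon>"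
        using \<epsilon> by (simp add: power2_eq_square)
      moreover have "16 / \<epsilon> \<le> 64 / \<epsilon>"
        using \<epsilon> by (intro divide_right_mono) auto
      ultimately show ?thesis
        using a by linarith
    qed
  qed
  moreover have Dpos: "0 < D"
    using D1 D3 unfolding D_def by linarith
  ultimately have "4 * \<alpha> / D \<le> \<epsilon>"
    using Dpos by (simp add: divide_le_eq)
  moreover have "(cmod (cayley (Complex 1 t) v))\<^sup>2 = 1 - 4 * \<alpha> / D"
    using v by (simp add: cayley_defect) (simp add: cmod_power2 \<alpha>_def \<beta>_def D_def)
  ultimately show ?thesis
    by simp
qed

definition slit_coord :: "complex \<Rightarrow> complex" where
  "slit_coord z = csqrt (1 / z - 1)"

text \<open>The previous estimate in the coordinate of the basin, where \<open>v\<^sup>2 = 1 / z - 1\<close>; the defect is taken to be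
  \<open>1 - (tanh C)\<^sup>2\<close>. The additional bound \<open>c < t\<close> makes the imaginary part \<open>2 t\<close> of
  \<open>(1 + \<i> t)\<^sup>2\<close> exceed \<open>c\<close>.\<close>

lemma cayley_slit_coord_far:
  fixes C :: real
  assumes "0 < C" "0 \<le> c"
  obtains t where "c < t" "\<And>z. \<lbrakk>1 / z - 1 \<notin> \<real>\<^sub>\<le>\<^sub>0; \<bar>Im (1 / z)\<bar> \<le> c\<rbrakk> \<Longrightarrow>
      C \<le> artanh (cmod (cayley (Complex 1 t) (slit_coord z)))"
proof
  define \<epsilon> where "\<epsilon> = 1 - (tanh C)\<^sup>2"
  have th: "0 < tanh C" "tanh C < 1"
    using assms tanh_real_lt_1 by auto
  then have \<epsilon>: "0 < \<epsilon>" "\<epsilon> \<le> 1"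
    by (auto simp: \<epsilon>_def power_less_one_iff)
  define t where "t = (c + 4) / \<epsilon> * 2"
  have "c * \<epsilon> \<le> c * 1"
    using \<epsilon> assms by (intro mult_left_mono) auto
  then show "c < t"
    using \<epsilon> assms by (simp add: t_def field_simps)
  fix z assume z: "1 / z - 1 \<notin> \<real>\<^sub>\<le>\<^sub>0" "\<bar>Im (1 / z)\<bar> \<le> c"
  have pos: "0 < Re (slit_coord z)"
    using Re_csqrt_pos[OF z(1)] by (simp add: slit_coord_def)
  have im: "\<bar>Im ((slit_coord z)\<^sup>2)\<bar> \<le> c"
    using z(2) unfolding slit_coord_def power2_csqrt minus_complex.simps one_complex.simps by linarith
  have "(tanh C)\<^sup>2 \<le> (cmod (cayley (Complex 1 t) (slit_coord z)))\<^sup>2"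
    using cayley_far[OF \<epsilon>(1) assms(2) t_def pos im] unfolding \<epsilon>_def by linarith
  then have "tanh C \<le> cmod (cayley (Complex 1 t) (slit_coord z))"
    by (rule power2_le_imp_le) (rule norm_ge_zero)
  moreover have "cmod (cayley (Complex 1 t) (slit_coord z)) < 1"
    by (rule norm_cayley_less_1[OF pos]) simp
  ultimately have "artanh (tanh C) \<le> artanh (cmod (cayley (Complex 1 t) (slit_coord z)))"
    using th by (intro artanh_real_mono) linarith+
  then show "C \<le> artanh (cmod (cayley (Complex 1 t) (slit_coord z)))"
    by (simp add: artanh_tanh_real)
qed

section \<open>A piece of the basin around the petal\<close>

lemma F_map_Pair: "F_map lam a (z, w) = (base_map z, of_real lam * w - 2 * z * w + a * w\<^sup>2)"
  by (simp add: F_map_def base_map_def)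

lemma fst_F_map: "fst (F_map lam a x) = base_map (fst x)"
  by (simp add: F_map_def base_map_def case_prod_unfold)

lemma fst_funpow_F_map: "fst ((F_map lam a ^^ n) x) = (base_map ^^ n) (fst x)"
  by (induction n) (simp_all add: fst_F_map)

lemma funpow_F_map_axis: "(F_map lam a ^^ n) (z, 0) = ((base_map ^^ n) z, 0)"
  by (induction n) (simp_all add: F_map_Pair)

lemma continuous_on_F_map: "continuous_on A (F_map lam a)"
  unfolding F_map_def case_prod_unfold by (intro continuous_intros)

abbreviation F_basin :: "real \<Rightarrow> complex \<Rightarrow> (complex \<times> complex) set" where
  "F_basin lam a \<equiv> attracting_basin (F_map lam a) (0, 0)"

lemma fst_F_basin:
  assumes "x \<in> F_basin lam a"
  shows "fst x \<in> base_basin"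
proof -
  obtain U where U: "open U" "x \<in> U" "uniform_limit U (\<lambda>n. F_map lam a ^^ n) (\<lambda>_. (0, 0)) sequentially"
    using assms by (auto simp: attracting_basin_def)
  have "uniform_limit (fst ` U) (\<lambda>n. base_map ^^ n) (\<lambda>_. 0) sequentially"
  proof (rule uniform_limitI)
    fix e :: real assume "0 < e"
    then have "\<forall>\<^sub>F n in sequentially. \<forall>y\<in>U. dist ((F_map lam a ^^ n) y) (0, 0) < e"
      using uniform_limitD[OF U(3)] by simp
    then show "\<forall>\<^sub>F n in sequentially. \<forall>z\<in>fst ` U. dist ((base_map ^^ n) z) 0 < e"
    proof eventually_elim
      case (elim n)
      show ?case
      proof clarify
        fix z w assume "(z, w) \<in> U"
        then have "dist ((F_map lam a ^^ n) (z, w)) (0, 0) < e"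
          using elim by blast
        then show "dist ((base_map ^^ n) (fst (z, w))) 0 < e"
          using dist_fst_le[of "(F_map lam a ^^ n) (z, w)" "(0, 0)"] by (simp add: fst_funpow_F_map)
      qed
    qed
  qed
  then show ?thesis
    using U(2) open_image_fst[OF U(1)] by (auto simp: attracting_basin_def)
qed

text \<open>The multiplier is a convex combination of \<open>1 - 2 z\<close> and \<open>- 2 z\<close>, and for small \<open>z\<close> the former has the
  larger modulus. Hence \<open>\<lambda> = 1\<close> is the worst case.\<close>

lemma norm_multiplier_le:
  assumes lam: "0 \<le> lam" "lam \<le> 1" and z: "cmod z \<le> 1/4"
  shows "cmod (of_real lam - 2 * z) \<le> cmod (1 - 2 * z)"
proof -
  have e: "of_real lam - 2 * z = of_real lam * (1 - 2 * z) + of_real (1 - lam) * (- 2 * z)"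
    by (simp add: algebra_simps)
  have "cmod (of_real lam - 2 * z) \<le> cmod (of_real lam * (1 - 2 * z)) + cmod (of_real (1 - lam) * (- 2 * z))"
    unfolding e by (rule norm_triangle_ineq)
  also have "\<dots> = lam * cmod (1 - 2 * z) + (1 - lam) * (2 * cmod z)"
    using lam by (simp add: norm_mult del: of_real_diff)
  also have "\<dots> \<le> lam * cmod (1 - 2 * z) + (1 - lam) * cmod (1 - 2 * z)"
  proof -
    have "2 * cmod z \<le> cmod (1 - 2 * z)"
      using norm_triangle_ineq2[of 1 "2 * z"] z by (simp add: norm_mult)
    then show ?thesis
      using lam by (intro add_left_mono mult_left_mono) auto
  qed
  finally show ?thesis
    by (simp add: algebra_simps)
qed

lemma petal_Re_ge:
  assumes "z \<in> petal"
  shows "cmod z \<le> sqrt 2 * Re z" and "0 < Re z"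
proof -
  have z0: "z \<noteq> 0"
    using assms by (rule petal_nonzero)
  have e: "1 / z = cnj z / of_real ((cmod z)\<^sup>2)"
    using z0 by (simp add: complex_div_cnj[of 1 z])
  have n: "0 < (cmod z)\<^sup>2"
    using z0 by simp
  have "\<bar>Im (1 / z)\<bar> < Re (1 / z)"
    using assms by (simp add: petal_def petal_height_def)
  then have "\<bar>Im z\<bar> / (cmod z)\<^sup>2 < Re z / (cmod z)\<^sup>2"
    unfolding e by (simp add: Re_divide_of_real Im_divide_of_real)
  then have lt: "\<bar>Im z\<bar> < Re z"
    using n by (simp add: divide_less_cancel)
  then show "0 < Re z"
    by simp
  have "(Im z)\<^sup>2 \<le> (Re z)\<^sup>2"
    using lt by (intro abs_le_square_iff[THEN iffD1]) simp
  then have "(cmod z)\<^sup>2 \<le> 2 * (Re z)\<^sup>2"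
    unfolding cmod_power2 by simp
  then have "sqrt ((cmod z)\<^sup>2) \<le> sqrt (2 * (Re z)\<^sup>2)"
    by (rule real_sqrt_le_mono)
  then show "cmod z \<le> sqrt 2 * Re z"
    using lt by (simp add: real_sqrt_mult)
qed

text \<open>The point of the sector shape: \<open>\<bar>1 - z\<bar> - \<bar>1 - 2 z\<bar>\<close> is about \<open>Re z\<close>, which on the petal is
  comparable to \<open>\<bar>z\<bar>\<close>. The margin leaves room for the term \<open>a w\<close> in
  the multiplier \<open>\<lambda> - 2 z + a w\<close> of the second coordinate.\<close>

lemma petal_margin:
  assumes z: "z \<in> petal"
  shows "cmod (1 - 2 * z) + cmod z / 4 \<le> cmod (1 - z)"
proof -
  define x m where "x = Re z" and "m = cmod z"
  have m: "0 \<le> m" "m \<le> 1/5"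
    using petal_norm_le[OF z] by (simp_all add: m_def)
  have x: "0 < x" "2/3 * m \<le> x"
  proof -
    show "0 < x"
      using petal_Re_ge(2)[OF z] by (simp add: x_def)
    have "sqrt 2 \<le> 3/2"
      by (rule real_le_lsqrt) (auto simp: power2_eq_square)
    then have "sqrt 2 * x \<le> 3/2 * x"
      using \<open>0 < x\<close> by (intro mult_right_mono) auto
    then show "2/3 * m \<le> x"
      using petal_Re_ge(1)[OF z] by (simp add: x_def m_def)
  qed
  have sq1: "(cmod (1 - 2 * z))\<^sup>2 = 1 - 4 * x + 4 * m\<^sup>2"
    unfolding x_def m_def cmod_power2 by (simp add: power2_eq_square algebra_simps)
  have sq2: "(cmod (1 - z))\<^sup>2 = 1 - 2 * x + m\<^sup>2"
    unfolding x_def m_def cmod_power2 by (simp add: power2_eq_square algebra_simps)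
  have up: "m / 4 \<le> cmod (1 - z)"
    using norm_triangle_ineq2[of 1 z] m by (simp add: m_def)
  have le1: "cmod (1 - z) \<le> 1"
  proof -
    have "m\<^sup>2 \<le> 2 * x"
    proof -
      have "m * m \<le> 1/5 * m" using m by (intro mult_right_mono) auto
      then show ?thesis using x m by (simp add: power2_eq_square)
    qed
    then have "(cmod (1 - z))\<^sup>2 \<le> 1\<^sup>2"
      unfolding sq2 by simp
    then show ?thesis
      by (rule power2_le_imp_le) simp
  qed
  have "(cmod (1 - 2 * z))\<^sup>2 \<le> (cmod (1 - z) - m / 4)\<^sup>2"
  proof -
    have "(cmod (1 - z) - m / 4)\<^sup>2 = 1 - 2 * x + m\<^sup>2 - m / 2 * cmod (1 - z) + m\<^sup>2 / 16"
      using sq2 by (simp add: power2_eq_square algebra_simps)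
    moreover have "m / 2 * cmod (1 - z) \<le> m / 2 * 1"
      using le1 m by (intro mult_left_mono) auto
    moreover have "m * m \<le> 1/5 * m"
      using m by (intro mult_right_mono) auto
    ultimately show ?thesis
      unfolding sq1 using x by (simp add: power2_eq_square)
  qed
  then have "cmod (1 - 2 * z) \<le> cmod (1 - z) - m / 4"
    by (rule power2_le_imp_le) (use up in simp)
  then show ?thesis
    by (simp add: m_def)
qed

text \<open>One step multiplies \<open>z\<close> by \<open>1 - z\<close> and, near the axis \<open>w = 0\<close>, multiplies \<open>w\<close> by a factor of smaller
  modulus; so for small \<open>\<epsilon>\<close> the cone \<open>\<bar>w\<bar> < \<epsilon> \<bar>z\<bar>\<close> over the petal is invariant.\<close>

definition local_basin :: "real \<Rightarrow> (complex \<times> complex) set" where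
  "local_basin \<epsilon> = {x. fst x \<in> petal \<and> cmod (snd x) < \<epsilon> * cmod (fst x)}"

lemma exists_local_basin_slope:
  fixes a :: complex
  shows "\<exists>\<epsilon>>0. cmod a * \<epsilon> \<le> 1/4"
proof (intro exI conjI)
  have pos: "0 < 1 + cmod a"
    by (simp add: add_pos_nonneg)
  then show "0 < 1 / (4 * (1 + cmod a))" "cmod a * (1 / (4 * (1 + cmod a))) \<le> 1/4"
    by (simp_all add: divide_simps)
qed

lemma local_basin_step:
  assumes lam: "0 \<le> lam" "lam \<le> 1" and \<epsilon>: "cmod a * \<epsilon> \<le> 1/4"
    and x: "x \<in> local_basin \<epsilon>"
  shows "F_map lam a x \<in> local_basin \<epsilon>"
proof -
  obtain z w where zw: "x = (z, w)"
    by (cases x)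
  have z: "z \<in> petal" and w: "cmod w < \<epsilon> * cmod z"
    using x by (auto simp: local_basin_def zw)
  have z5: "cmod z \<le> 1/5"
    using z by (rule petal_norm_le)
  have e0: "0 < \<epsilon> * cmod z"
    using w norm_ge_zero[of w] by linarith
  have aw: "cmod (a * w) \<le> cmod z / 4"
  proof -
    have "cmod (a * w) \<le> cmod a * (\<epsilon> * cmod z)"
      unfolding norm_mult using w by (intro mult_left_mono) auto
    also have "\<dots> = cmod a * \<epsilon> * cmod z"
      by simp
    also have "\<dots> \<le> 1/4 * cmod z"
      using \<epsilon> by (intro mult_right_mono) auto
    finally show ?thesis
      by simp
  qed
  have eq: "of_real lam * w - 2 * z * w + a * w\<^sup>2 = w * (of_real lam - 2 * z + a * w)"
    by (simp add: power2_eq_square algebra_simps)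
  have fac: "cmod (of_real lam - 2 * z + a * w) \<le> cmod (1 - z)"
    using norm_triangle_ineq[of "of_real lam - 2 * z" "a * w"] norm_multiplier_le[OF lam, of z]
      aw z5 petal_margin[OF z] by linarith
  have pos: "0 < cmod (1 - z)"
    using z5 by auto
  have "cmod (w * (of_real lam - 2 * z + a * w)) \<le> cmod w * cmod (1 - z)"
    unfolding norm_mult using fac by (intro mult_left_mono) auto
  also have "\<dots> < \<epsilon> * cmod z * cmod (1 - z)"
    using w pos by (intro mult_strict_right_mono) auto
  also have "\<dots> = \<epsilon> * cmod (base_map z)"
  proof -
    have "base_map z = z * (1 - z)"
      by (simp add: base_map_def power2_eq_square algebra_simps)
    then show ?thesis
      by (simp add: norm_mult)
  qed
  finally show ?thesis
    using base_map_in_petal[OF z] by (simp add: zw F_map_Pair local_basin_def eq)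
qed

lemma open_petal: "open petal"
proof -
  have "petal = {z. z \<noteq> 0} \<inter> petal_height -` {5<..}"
    using petal_nonzero by (auto simp: petal_def)
  moreover have "open ({z. z \<noteq> 0} \<inter> petal_height -` {5<..})"
    unfolding petal_height_def
    by (intro continuous_open_preimage continuous_intros) (auto simp: open_Collect_neq)
  ultimately show ?thesis
    by simp
qed

lemma open_local_basin: "open (local_basin \<epsilon>)"
proof -
  have "local_basin \<epsilon> = fst -` petal \<inter> {x. cmod (snd x) < \<epsilon> * cmod (fst x)}"
    by (auto simp: local_basin_def)
  moreover have "open (fst -` petal :: (complex \<times> complex) set)"
    by (simp add: open_petal open_vimage_fst)
  moreover have "open {x :: complex \<times> complex. cmod (snd x) < \<epsilon> * cmod (fst x)}"
    by (intro open_Collect_less continuous_intros)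
  ultimately show ?thesis
    by auto
qed

text \<open>On this invariant set \<open>\<bar>z\<bar>\<close> is at most \<open>2 / n\<close> after \<open>n\<close> steps, uniformly, and \<open>\<bar>w\<bar>\<close> is dominated by
  \<open>\<epsilon> \<bar>z\<bar>\<close>.\<close>

lemma local_basin_subset:
  assumes lam: "0 \<le> lam" "lam \<le> 1" and \<epsilon>: "cmod a * \<epsilon> \<le> 1/4"
  shows "local_basin \<epsilon> \<subseteq> F_basin lam a"
proof -
  let ?F = "F_map lam a"
  have inv: "(?F ^^ n) x \<in> local_basin \<epsilon>" if "x \<in> local_basin \<epsilon>" for n x
    using that by (induction n) (auto intro: local_basin_step[OF lam \<epsilon>])
  have small: "dist ((?F ^^ n) x) (0, 0) \<le> (1 + \<bar>\<epsilon>\<bar>) * (2 / n)" if x: "x \<in> local_basin \<epsilon>" and n: "0 < n" for n x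
  proof -
    obtain z w where zw: "(?F ^^ n) x = (z, w)"
      by (cases "(?F ^^ n) x")
    have w: "cmod w < \<epsilon> * cmod z"
      using inv[OF x, of n] by (simp add: zw local_basin_def)
    have "z = (base_map ^^ n) (fst x)"
      using fst_funpow_F_map[of n lam a x] zw by simp
    moreover have "fst x \<in> petal"
      using x by (simp add: local_basin_def)
    ultimately have "real n / 2 \<le> petal_height z"
      using petal_height_funpow[of "fst x" n] by simp
    then have z: "cmod z \<le> 2 / n"
      using norm_le_of_petal_height[of "real n / 2" z] n by simp
    have "dist ((?F ^^ n) x) (0, 0) \<le> cmod z + cmod w"
      using norm_Pair_le[of z w] by (simp add: zw dist_norm)
    also have "\<dots> \<le> cmod z + \<bar>\<epsilon>\<bar> * cmod z"
      using w mult_right_mono[OF abs_ge_self norm_ge_zero, of \<epsilon> z] by linarith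
    also have "\<dots> = (1 + \<bar>\<epsilon>\<bar>) * cmod z"
      by (simp add: algebra_simps)
    also have "\<dots> \<le> (1 + \<bar>\<epsilon>\<bar>) * (2 / n)"
      using z by (intro mult_left_mono) auto
    finally show ?thesis .
  qed
  have "uniform_limit (local_basin \<epsilon>) (\<lambda>n. ?F ^^ n) (\<lambda>_. (0, 0)) sequentially"
  proof (rule uniform_limitI)
    fix e :: real assume e: "0 < e"
    have "(\<lambda>n. (1 + \<bar>\<epsilon>\<bar>) * (2 / real n)) \<longlonglongrightarrow> (1 + \<bar>\<epsilon>\<bar>) * 0"
      by (intro tendsto_mult tendsto_const lim_const_over_n)
    then have "\<forall>\<^sub>F n in sequentially. (1 + \<bar>\<epsilon>\<bar>) * (2 / real n) < e"
      using e by (intro order_tendstoD(2)) auto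
    then show "\<forall>\<^sub>F n in sequentially. \<forall>x\<in>local_basin \<epsilon>. dist ((?F ^^ n) x) (0, 0) < e"
      using eventually_gt_at_top[of 0]
    proof eventually_elim
      case (elim n)
      then show ?case
        using le_less_trans[OF small] by blast
    qed
  qed
  then show ?thesis
    using open_local_basin by (auto simp: attracting_basin_def)
qed

section \<open>Openness, properness, and orbits approaching the axis\<close>

lemma open_image_map_prod:
  fixes f :: "'a::topological_space \<Rightarrow> 'b::topological_space" and g :: "'c::topological_space \<Rightarrow> 'd::topological_space"
  assumes f: "\<And>U. open U \<Longrightarrow> open (f ` U)" and g: "\<And>U. open U \<Longrightarrow> open (g ` U)" and U: "open U"
  shows "open (map_prod f g ` U)"
proof (subst open_subopen, rule ballI)
  fix p assume "p \<in> map_prod f g ` U"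
  then obtain x y where xy: "(x, y) \<in> U" "p = map_prod f g (x, y)"
    by auto
  obtain A B where AB: "open A" "open B" "(x, y) \<in> A \<times> B" "A \<times> B \<subseteq> U"
    using open_prod_elim[OF U xy(1)] by metis
  have "open (map_prod f g ` (A \<times> B))"
    using AB f g by (simp add: map_prod_surj_on[OF refl refl] open_Times)
  moreover have "p \<in> map_prod f g ` (A \<times> B)" "map_prod f g ` (A \<times> B) \<subseteq> map_prod f g ` U"
    using AB xy(2) by blast+
  ultimately show "\<exists>T. open T \<and> p \<in> T \<and> T \<subseteq> map_prod f g ` U"
    by blast
qed

lemma open_image_shear:
  fixes s :: "complex \<Rightarrow> complex"
  assumes s: "continuous_on UNIV s" and U: "open U"
  shows "open ((\<lambda>(z, w). (z, w + s z)) ` U)"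
proof -
  have "(\<lambda>(z, w). (z, w + s z)) ` U = (\<lambda>x. (fst x, snd x - s (fst x))) -` U"
  proof (intro equalityI subsetI)
    fix x assume "x \<in> (\<lambda>x. (fst x, snd x - s (fst x))) -` U"
    then have "(fst x, snd x - s (fst x)) \<in> U"
      by simp
    then have "(\<lambda>(z, w). (z, w + s z)) (fst x, snd x - s (fst x)) \<in> (\<lambda>(z, w). (z, w + s z)) ` U"
      by (rule imageI)
    then show "x \<in> (\<lambda>(z, w). (z, w + s z)) ` U"
      by simp
  qed auto
  moreover have "continuous_on UNIV (\<lambda>x :: complex \<times> complex. (fst x, snd x - s (fst x)))"
    by (intro continuous_intros continuous_on_compose2[OF s]) auto
  ultimately show ?thesis
    using U by (simp add: open_vimage)
qed

text \<open>Completing the square in \<open>w\<close> factors \<open>F\<close> into two shears, the squaring map of the second coordinate, and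
  \<open>p\<close> on the first; each factor is open.\<close>

lemma open_image_F_map:
  assumes a: "a \<noteq> 0" and U: "open U"
  shows "open (F_map lam a ` U)"
proof -
  define s where "s z = (of_real lam - 2 * z) / (2 * a)" for z
  define sh where "sh r = (\<lambda>(z :: complex, w :: complex). (z, w + r z :: complex))" for r
  have "F_map lam a = map_prod base_map id \<circ> sh (\<lambda>z. - a * (s z)\<^sup>2) \<circ> map_prod id (\<lambda>v. a * v\<^sup>2) \<circ> sh s"
  proof
    fix x :: "complex \<times> complex"
    obtain z w where x: "x = (z, w)"
      by (cases x)
    have "of_real lam - 2 * z = 2 * a * s z"
      using a by (simp add: s_def)
    then have "of_real lam * w - 2 * z * w + a * w\<^sup>2 = 2 * a * s z * w + a * w\<^sup>2"
      by (metis left_diff_distrib)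
    also have "\<dots> = a * (w + s z)\<^sup>2 + (- a * (s z)\<^sup>2)"
      by (simp add: power2_eq_square algebra_simps)
    finally show "F_map lam a x = (map_prod base_map id \<circ> sh (\<lambda>z. - a * (s z)\<^sup>2) \<circ> map_prod id (\<lambda>v. a * v\<^sup>2) \<circ> sh s) x"
      by (simp add: x F_map_Pair sh_def)
  qed
  moreover have cont: "continuous_on UNIV s" "continuous_on UNIV (\<lambda>z. - a * (s z)\<^sup>2)"
    unfolding s_def using a by (intro continuous_intros; simp)+
  have o1: "open (sh s ` U)"
    unfolding sh_def using open_image_shear[OF cont(1) U] .
  have o2: "open (map_prod id (\<lambda>v. a * v\<^sup>2) ` sh s ` U)"
  proof (rule open_image_map_prod[OF _ _ o1])
    fix V :: "complex set" assume V: "open V"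
    show "open (id ` V)"
      using V by simp
    show "open ((\<lambda>v. a * v\<^sup>2) ` V)"
      using a V by (intro open_image_entire[of _ 0 1]) (auto intro!: holomorphic_intros)
  qed
  have o3: "open (sh (\<lambda>z. - a * (s z)\<^sup>2) ` map_prod id (\<lambda>v. a * v\<^sup>2) ` sh s ` U)"
    using open_image_shear[OF cont(2) o2] by (simp only: sh_def)
  have "open (map_prod base_map id ` sh (\<lambda>z. - a * (s z)\<^sup>2) ` map_prod id (\<lambda>v. a * v\<^sup>2) ` sh s ` U)"
    by (rule open_image_map_prod[OF _ _ o3]) (simp_all add: open_image_base_map)
  ultimately show ?thesis
    by (simp only: image_comp comp_assoc)
qed

lemma F_map_proper:
  assumes a: "a \<noteq> 0"
  shows "\<exists>R'. \<forall>x. norm (F_map lam a x) \<le> R \<longrightarrow> norm x \<le> R'"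
proof -
  obtain Q where Q: "\<And>z. norm (base_map z) \<le> R \<Longrightarrow> norm z \<le> Q"
    using base_map_proper by blast
  define M where "M = (\<bar>lam\<bar> + 2 * Q + \<bar>R\<bar>) / cmod a + 1"
  have "norm x \<le> Q + M" if le: "norm (F_map lam a x) \<le> R" for x
  proof -
    obtain z w where x: "x = (z, w)"
      by (cases x)
    have "norm (base_map z) \<le> R"
      using le norm_fst_le[of "base_map z" "snd (F_map lam a x)"] by (simp add: F_map_Pair x)
    then have z: "cmod z \<le> Q"
      by (rule Q)
    then have Q0: "0 \<le> Q"
      using norm_ge_zero order_trans by blast
    have "cmod (w * (a * w + (of_real lam - 2 * z))) \<le> R"
      using le norm_snd_le[of "w * (a * w + (of_real lam - 2 * z))" "base_map z"]
      by (simp add: x F_map_Pair power2_eq_square algebra_simps)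
    then have prod: "cmod w * cmod (a * w + (of_real lam - 2 * z)) \<le> \<bar>R\<bar>"
      by (simp add: norm_mult)
    have "cmod w \<le> M"
    proof (rule ccontr)
      assume "\<not> cmod w \<le> M"
      then have w: "M < cmod w"
        by simp
      then have "1 < cmod w"
        using Q0 unfolding M_def by (smt (verit) divide_nonneg_nonneg norm_ge_zero)
      have "cmod (of_real lam - 2 * z) \<le> \<bar>lam\<bar> + 2 * Q"
        using norm_triangle_ineq4[of "of_real lam" "2 * z"] z by (simp add: norm_mult)
      moreover have "\<bar>lam\<bar> + 2 * Q + \<bar>R\<bar> < cmod a * cmod w"
      proof -
        have "(\<bar>lam\<bar> + 2 * Q + \<bar>R\<bar>) / cmod a < cmod w"
          using w by (simp add: M_def)
        then show ?thesis
          using a by (simp add: divide_less_eq mult.commute)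
      qed
      ultimately have "\<bar>R\<bar> < cmod (a * w + (of_real lam - 2 * z))"
        using norm_diff_ineq[of "a * w" "of_real lam - 2 * z"] by (simp add: norm_mult)
      then have "1 * \<bar>R\<bar> < cmod w * cmod (a * w + (of_real lam - 2 * z))"
        using \<open>1 < cmod w\<close> by (intro mult_less_le_imp_less mult_strict_mono) auto
      then show False
        using prod by simp
    qed
    then show ?thesis
      using z norm_Pair_le[of z w] x by simp
  qed
  then show ?thesis
    by blast
qed

text \<open>Cesaro's theorem, in the form for sequences with convergent increments.\<close>

lemma increments_tendsto_imp_average:
  fixes u :: "nat \<Rightarrow> 'a::real_normed_field"
  assumes "(\<lambda>n. u (Suc n) - u n) \<longlonglongrightarrow> l"
  shows "(\<lambda>n. u n / of_nat n) \<longlonglongrightarrow> l"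
proof (rule LIMSEQ_I)
  fix e :: real assume e: "0 < e"
  obtain N where N: "\<And>n. N \<le> n \<Longrightarrow> norm (u (Suc n) - u n - l) < e / 2"
    using LIMSEQ_D[OF assms, of "e / 2"] e by auto
  have dev: "norm (u (N + k) - u N - of_nat k * l) \<le> k * (e / 2)" for k
  proof (induction k)
    case (Suc k)
    have "u (N + Suc k) - u N - of_nat (Suc k) * l
        = (u (N + k) - u N - of_nat k * l) + (u (Suc (N + k)) - u (N + k) - l)"
      by (simp add: algebra_simps)
    then have "norm (u (N + Suc k) - u N - of_nat (Suc k) * l)
        \<le> norm (u (N + k) - u N - of_nat k * l) + norm (u (Suc (N + k)) - u (N + k) - l)"
      by (metis norm_triangle_ineq)
    also have "\<dots> \<le> k * (e / 2) + e / 2"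
      using Suc N[of "N + k"] by (intro add_mono) auto
    finally show ?case
      by (simp add: algebra_simps add_divide_distrib)
  qed simp
  define M where "M = norm (u N - of_nat N * l)"
  obtain n\<^sub>0 :: nat where n0: "2 * M / e < n\<^sub>0"
    using reals_Archimedean2 by blast
  have "norm (u n / of_nat n - l) < e" if n: "max (Suc N) n\<^sub>0 \<le> n" for n
  proof -
    obtain k where k: "n = N + k"
      using n by (metis le_Suc_ex max.boundedE Suc_leD)
    have pos: "0 < real n"
      using n by simp
    have "u n - of_nat n * l = (u (N + k) - u N - of_nat k * l) + (u N - of_nat N * l)"
      by (simp add: k algebra_simps)
    then have "norm (u n - of_nat n * l) \<le> k * (e / 2) + M"
      using norm_triangle_ineq[of "u (N + k) - u N - of_nat k * l" "u N - of_nat N * l"] dev[of k]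
      by (simp add: M_def)
    also have "k * (e / 2) \<le> n * (e / 2)"
      using e k by (intro mult_right_mono) auto
    also have "M < n * (e / 2)"
    proof -
      have "2 * M / e < n"
        using n0 n by linarith
      then show ?thesis
        using e by (simp add: field_simps)
    qed
    finally have lt: "norm (u n - of_nat n * l) < e * n"
      by (simp add: mult.commute)
    have "u n / of_nat n - l = (u n - of_nat n * l) / of_nat n"
      using pos by (simp add: diff_divide_distrib)
    then have "norm (u n / of_nat n - l) = norm (u n - of_nat n * l) / n"
      by (simp add: norm_divide)
    also have "\<dots> < e"
      using lt pos by (simp add: divide_less_eq)
    finally show ?thesis .
  qed
  then show "\<exists>no. \<forall>n\<ge>no. norm (u n / of_nat n - l) < e"
    by blast
qed

text \<open>The increments of \<open>1 / z\<close> along the orbit are \<open>1 / (1 - z)\<close> and tend to \<open>1\<close>.\<close>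

lemma recip_orbit_asymptotics:
  assumes lim: "(\<lambda>n. (base_map ^^ n) z) \<longlonglongrightarrow> 0" and ne: "\<And>n. (base_map ^^ n) z \<noteq> 0"
  shows "(\<lambda>n. 1 / (base_map ^^ n) z / of_nat n) \<longlonglongrightarrow> 1"
proof (rule increments_tendsto_imp_average)
  have "(\<lambda>n. 1 / (1 - (base_map ^^ n) z)) \<longlonglongrightarrow> 1 / (1 - 0)"
    by (intro tendsto_intros lim) simp
  moreover have "1 / (1 - (base_map ^^ n) z) = 1 / (base_map ^^ Suc n) z - 1 / (base_map ^^ n) z" for n
  proof -
    have "base_map ((base_map ^^ n) z) = (base_map ^^ n) z * (1 - (base_map ^^ n) z)"
      by (simp add: base_map_def power2_eq_square algebra_simps)
    moreover from this have "1 - (base_map ^^ n) z \<noteq> 0"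
      using ne[of "Suc n"] by auto
    ultimately show ?thesis
      using ne[of n] by (simp add: divide_simps)
  qed
  ultimately show "(\<lambda>n. 1 / (base_map ^^ Suc n) z - 1 / (base_map ^^ n) z) \<longlonglongrightarrow> 1"
    by simp
qed

text \<open>For \<open>\<lambda> = 1\<close> the polynomial \<open>p\<close> also governs the distance \<open>z - a w\<close> from the invariant line \<open>z = a w\<close>.
  Consequently \<open>F\<close> is then linearly conjugate to \<open>p \<times> p\<close> if \<open>a \<noteq> 0\<close>.\<close>

lemma F_map_1_line_coord: "fst (F_map 1 a x) - a * snd (F_map 1 a x) = base_map (fst x - a * snd x)"
  by (simp add: F_map_def base_map_def case_prod_unfold power2_eq_square algebra_simps)

lemma funpow_F_map_1_line_coord:
  "fst ((F_map 1 a ^^ n) x) - a * snd ((F_map 1 a ^^ n) x) = (base_map ^^ n) (fst x - a * snd x)"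
  by (induction n) (simp_all add: F_map_1_line_coord)

text \<open>The claim is that \<open>w / z\<close> tends to \<open>0\<close>. For \<open>\<lambda> < 1\<close> its multiplier
  \<open>(\<lambda> - 2 z + a w) / (1 - z)\<close> tends to \<open>\<lambda>\<close>. For \<open>\<lambda> = 1\<close> both \<open>z\<close> and \<open>z - a w\<close> are orbits of \<open>p\<close>, with the
  same asymptotics \<open>1 / n\<close>, so their quotient tends to \<open>1\<close>. Orbits in the line \<open>z = a w\<close> are a genuine
  exception.\<close>

lemma enters_local_basin:
  fixes lam :: real and a :: complex and Z W :: "nat \<Rightarrow> complex"
  assumes lam: "0 < lam" "lam \<le> 1" and a: "a \<noteq> 0" and \<epsilon>: "0 < \<epsilon>"
    and orbit: "\<And>n. (F_map lam a ^^ n) x = (Z n, W n)"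
    and Z: "Z \<longlonglongrightarrow> 0" "\<And>n. Z n \<noteq> 0" and W: "W \<longlonglongrightarrow> 0"
    and off: "lam = 1 \<Longrightarrow> \<forall>n. a * W n \<noteq> Z n"
  shows "\<exists>n. (F_map lam a ^^ n) x \<in> local_basin \<epsilon>"
proof -
  have step: "(Z (Suc n), W (Suc n)) = F_map lam a (Z n, W n)" for n
    using orbit[of n] orbit[of "Suc n"] by simp
  have ZS: "Z (Suc n) = Z n * (1 - Z n)" for n
    using step[of n] by (simp add: F_map_Pair base_map_def power2_eq_square algebra_simps)
  have WS: "W (Suc n) = W n * (of_real lam - 2 * Z n + a * W n)" for n
    using step[of n] by (simp add: F_map_Pair power2_eq_square algebra_simps)
  have Zb: "Z n = (base_map ^^ n) (fst x)" for n
    using fst_funpow_F_map[of n lam a x] by (simp add: orbit)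
  obtain N0 where "Z N0 \<in> petal"
    using eventually_in_petal[of "fst x"] Z by (auto simp: Zb[symmetric])
  then have petal: "Z n \<in> petal" if "N0 \<le> n" for n
    using funpow_base_map_in_petal[of "Z N0" "n - N0"] that
    by (simp add: Zb funpow_add[symmetric, THEN fun_cong, unfolded comp_def])
  have ev: "\<forall>\<^sub>F n in sequentially. cmod (W n) < \<epsilon> * cmod (Z n)"
  proof (cases "lam = 1")
    case False
    define \<mu> where "\<mu> = (1 + lam) / 2"
    have \<mu>: "lam < \<mu>" "\<mu> < 1" "0 < \<mu>"
      using False lam by (auto simp: \<mu>_def)
    have "(\<lambda>n. cmod ((of_real lam - 2 * Z n + a * W n) / (1 - Z n))) \<longlonglongrightarrow> cmod ((of_real lam - 2 * 0 + a * 0) / (1 - 0))"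
      by (intro tendsto_intros Z W) auto
    then have "\<forall>\<^sub>F n in sequentially. cmod ((of_real lam - 2 * Z n + a * W n) / (1 - Z n)) < \<mu>"
      using \<mu> lam by (intro order_tendstoD(2)) auto
    then obtain N where N: "\<And>n. N \<le> n \<Longrightarrow> cmod ((of_real lam - 2 * Z n + a * W n) / (1 - Z n)) < \<mu>"
      by (auto simp: eventually_sequentially)
    have r: "cmod (W (N + k) / Z (N + k)) \<le> cmod (W N / Z N) * \<mu> ^ k" for k
    proof (induction k)
      case (Suc k)
      have "W (Suc (N + k)) / Z (Suc (N + k))
          = W (N + k) / Z (N + k) * ((of_real lam - 2 * Z (N + k) + a * W (N + k)) / (1 - Z (N + k)))"
        by (simp add: ZS WS)
      then have "cmod (W (Suc (N + k)) / Z (Suc (N + k)))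
          = cmod (W (N + k) / Z (N + k)) * cmod ((of_real lam - 2 * Z (N + k) + a * W (N + k)) / (1 - Z (N + k)))"
        by (simp only: norm_mult)
      also have "\<dots> \<le> (cmod (W N / Z N) * \<mu> ^ k) * \<mu>"
        using Suc N[of "N + k"] \<mu> by (intro mult_mono) auto
      finally show ?case
        by (simp add: mult_ac)
    qed simp
    have "(\<lambda>k. cmod (W N / Z N) * \<mu> ^ k) \<longlonglongrightarrow> cmod (W N / Z N) * 0"
      using \<mu> by (intro tendsto_intros LIMSEQ_realpow_zero) auto
    then have "\<forall>\<^sub>F k in sequentially. cmod (W N / Z N) * \<mu> ^ k < \<epsilon>"
      using \<epsilon> by (intro order_tendstoD(2)) auto
    then have "\<forall>\<^sub>F k in sequentially. cmod (W (k + N)) < \<epsilon> * cmod (Z (k + N))"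
    proof eventually_elim
      case (elim k)
      then have "cmod (W (N + k)) / cmod (Z (N + k)) < \<epsilon>"
        using r[of k] by (simp add: norm_divide)
      then show ?case
        using Z(2)[of "N + k"] by (simp add: divide_less_eq add.commute)
    qed
    then show ?thesis
      by (rule eventually_sequentially_seg[THEN iffD1])
  next
    case True
    define D where "D n = Z n - a * W n" for n
    have Db: "D n = (base_map ^^ n) (D 0)" for n
      using funpow_F_map_1_line_coord[where a = a and x = x and n = n] orbit[of n] orbit[of 0]
      by (simp add: D_def True)
    have Dne: "D n \<noteq> 0" for n
      using off True by (simp add: D_def eq_commute[of "Z n"])
    have "(\<lambda>n. Z n - a * W n) \<longlonglongrightarrow> 0 - a * 0"
      by (intro tendsto_intros Z W)
    then have "D \<longlonglongrightarrow> 0"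
      by (simp add: D_def[abs_def])
    then have Das: "(\<lambda>n. 1 / D n / of_nat n) \<longlonglongrightarrow> 1"
      using recip_orbit_asymptotics[of "D 0"] Dne by (simp add: Db[symmetric])
    have Zas: "(\<lambda>n. 1 / Z n / of_nat n) \<longlonglongrightarrow> 1"
      using recip_orbit_asymptotics[of "fst x"] Z by (simp add: Zb[symmetric])
    have "(\<lambda>n. (1 - (1 / Z n / of_nat n) / (1 / D n / of_nat n)) / a) \<longlonglongrightarrow> (1 - 1 / 1) / a"
      using a by (intro tendsto_intros Zas Das) auto
    then have "\<forall>\<^sub>F n in sequentially. cmod ((1 - (1 / Z n / of_nat n) / (1 / D n / of_nat n)) / a) < \<epsilon>"
      using \<epsilon> by (intro order_tendstoD(2)[OF tendsto_norm]) auto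
    then show ?thesis
      using eventually_gt_at_top[of 0]
    proof eventually_elim
      case (elim n)
      have "(1 / Z n / of_nat n) / (1 / D n / of_nat n) = D n / Z n"
        using elim(2) Dne[of n] Z(2)[of n] by (simp add: divide_simps)
      moreover have "(1 - D n / Z n) / a = W n / Z n"
        using a Z(2)[of n] by (simp add: D_def divide_simps)
      ultimately have "(1 - (1 / Z n / of_nat n) / (1 / D n / of_nat n)) / a = W n / Z n"
        by simp
      then have "cmod (W n) / cmod (Z n) < \<epsilon>"
        using elim(1) by (metis norm_divide)
      then show ?case
        using Z(2)[of n] by (simp add: divide_less_eq)
    qed
  qed
  then obtain N2 where "\<And>n. N2 \<le> n \<Longrightarrow> cmod (W n) < \<epsilon> * cmod (Z n)"
    by (auto simp: eventually_sequentially)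
  then have "(F_map lam a ^^ (max N0 N2)) x \<in> local_basin \<epsilon>"
    using petal[of "max N0 N2"] by (simp add: local_basin_def orbit)
  then show ?thesis ..
qed

section \<open>Every component reaches the tract\<close>

text \<open>In the coordinate \<open>u = 1 / z\<close>: the part of the axis \<open>w = 0\<close> that is known to lie in the basin, a
  half-plane in the tract together with the petal.\<close>

definition axis_coords :: "complex set" where
  "axis_coords = {u. tract_height < Im u} \<union> {u. 5 < Re u - \<bar>Im u\<bar>}"

lemma connected_axis_coords: "connected axis_coords"
proof -
  have "{u. 5 < Re u - \<bar>Im u\<bar>} = {u. inner (Complex 1 1) u > 5} \<inter> {u. inner (Complex 1 (- 1)) u > 5}"
    by (auto simp: inner_complex_def)
  then have "convex {u. 5 < Re u - \<bar>Im u\<bar>}"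
    by (simp add: convex_Int convex_halfspace_gt)
  then have c2: "connected {u. 5 < Re u - \<bar>Im u\<bar>}"
    by (rule convex_connected)
  have c1: "connected {u. tract_height < Im u}"
    by (intro convex_connected convex_halfspace_Im_gt)
  define h :: real where "h = tract_height + 1"
  have "0 < h"
    using tract_height_pos by (simp add: h_def)
  then have "Complex (h + 6) h \<in> {u. tract_height < Im u} \<inter> {u. 5 < Re u - \<bar>Im u\<bar>}"
    by (simp add: h_def)
  then show ?thesis
    unfolding axis_coords_def by (intro connected_Un c1 c2) blast
qed

lemma axis_coords_nonzero: "u \<in> axis_coords \<Longrightarrow> u \<noteq> 0"
  using tract_height_pos by (auto simp: axis_coords_def)

lemma axis_subset_F_basin:
  assumes lam: "0 < lam" "lam \<le> 1" and u: "u \<in> axis_coords"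
  shows "(1 / u, 0) \<in> F_basin lam a"
proof -
  obtain \<epsilon> where \<epsilon>: "0 < \<epsilon>" "cmod a * \<epsilon> \<le> 1/4"
    using exists_local_basin_slope by blast
  obtain n where n: "(base_map ^^ n) (1 / u) \<in> petal"
  proof (cases "tract_height < Im u")
    case True
    then show ?thesis
      using upper_tract_enters_petal[OF in_upper_tract, of "1 / u"] that by auto
  next
    case False
    then have "1 / u \<in> petal"
      using u by (auto simp: axis_coords_def petal_def petal_height_def)
    then show ?thesis
      using that[of 0] by simp
  qed
  then have "(F_map lam a ^^ n) (1 / u, 0) \<in> local_basin \<epsilon>"
    using \<epsilon> petal_nonzero[OF n] by (simp add: funpow_F_map_axis local_basin_def)
  then have "(F_map lam a ^^ n) (1 / u, 0) \<in> F_basin lam a"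
    using local_basin_subset[of lam a \<epsilon>] lam \<epsilon> by auto
  then show ?thesis
    by (rule attracting_basin_vimage_funpow[OF continuous_on_F_map])
qed

text \<open>The connecting set is a segment in the fibre of \<open>x\<close>, ending on the axis, together with the known part of
  the axis.\<close>

lemma local_basin_joined_to_axis:
  assumes lam: "0 < lam" "lam \<le> 1" and \<epsilon>: "0 < \<epsilon>" "cmod a * \<epsilon> \<le> 1/4"
    and x: "x \<in> local_basin \<epsilon>" and z: "tract_height < Im (1 / z)"
  shows "\<exists>T. connected T \<and> T \<subseteq> F_basin lam a \<and> x \<in> T \<and> (z, 0) \<in> T"
proof -
  let ?ax = "(\<lambda>u. (1 / u, 0 :: complex)) ` axis_coords"
  obtain y w where yw: "x = (y, w)"
    by (cases x)
  have y: "y \<in> petal" and w: "cmod w < \<epsilon> * cmod y"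
    using x by (auto simp: yw local_basin_def)
  let ?seg = "(\<lambda>t. (y, of_real t * w)) ` {0..1 :: real}"
  have "continuous_on axis_coords (\<lambda>u. (1 / u, 0 :: complex))"
    by (intro continuous_intros) (auto dest: axis_coords_nonzero)
  then have c1: "connected ?ax"
    using connected_axis_coords by (rule connected_continuous_image)
  have c2: "connected ?seg"
    by (intro connected_continuous_image continuous_intros) auto
  have "1 / y \<in> axis_coords"
    using y by (simp add: axis_coords_def petal_def petal_height_def)
  then have "(1 / (1 / y), 0) \<in> ?ax"
    by (rule imageI)
  moreover have "(y, of_real 0 * w) \<in> ?seg"
    by (rule imageI) simp
  ultimately have "(y, 0) \<in> ?ax \<inter> ?seg"
    by simp
  then have conn: "connected (?ax \<union> ?seg)"
    by (intro connected_Un c1 c2) blast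
  have "?seg \<subseteq> local_basin \<epsilon>"
  proof clarify
    fix t :: real assume t: "t \<in> {0..1}"
    have "cmod (of_real t * w) \<le> 1 * cmod w"
      unfolding norm_mult using t by (intro mult_right_mono) auto
    then show "(y, of_real t * w) \<in> local_basin \<epsilon>"
      using y w by (simp add: local_basin_def)
  qed
  then have "?ax \<union> ?seg \<subseteq> F_basin lam a"
    using axis_subset_F_basin[OF lam] local_basin_subset[of lam a \<epsilon>] lam \<epsilon>(2) by auto
  moreover have "(y, of_real 1 * w) \<in> ?seg"
    by (rule imageI) simp
  then have "x \<in> ?seg"
    by (simp add: yw)
  moreover have "1 / z \<in> axis_coords"
    using z by (simp add: axis_coords_def)
  then have "(1 / (1 / z), 0) \<in> ?ax"
    by (rule imageI)
  then have "(z, 0) \<in> ?ax"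
    by simp
  ultimately show ?thesis
    using conn by blast
qed

text \<open>Some iterate of the component is again a component and meets \<open>local_basin\<close>, hence contains \<open>(z, 0)\<close>.
  For \<open>\<lambda> = 1\<close> the starting point must be chosen off the preimages of the line \<open>z = a w\<close>. First a neighbourhood of a point
  of the component is iterated until its further iterates are uniformly small. Its image is then open, so
  it contains a point off the line; later iterates do not return to the line if \<open>\<lambda> = 1\<close>, because
  \<open>d = z - a w\<close> then becomes \<open>d (1 - d)\<close> and \<open>\<bar>d\<bar> < 1\<close>.\<close>

lemma component_reaches_tract_nonlinear:
  assumes lam: "0 < lam" "lam \<le> 1" and a: "a \<noteq> 0"
    and C: "C \<in> components (F_basin lam a)" and z: "tract_height < Im (1 / z)"
  shows "\<exists>k. \<exists>x\<in>C. (base_map ^^ k) (fst x) = z"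
proof -
  let ?F = "F_map lam a"
  have opn: "\<And>U. open U \<Longrightarrow> open (?F ` U)"
    using a by (rule open_image_F_map)
  have opnk: "open ((?F ^^ n) ` U)" if "open U" for n U
  proof (induction n)
    case (Suc n)
    then show ?case
      using opn[OF Suc] by (simp add: image_comp)
  qed (use that in simp)
  obtain \<epsilon> where \<epsilon>: "0 < \<epsilon>" "cmod a * \<epsilon> \<le> 1/4"
    using exists_local_basin_slope by blast
  obtain p where p: "p \<in> C"
    using in_components_nonempty[OF C] by blast
  have CS: "C \<subseteq> F_basin lam a"
    using C by (rule in_components_subset)
  have Cop: "open C"
    using open_components[OF open_attracting_basin C] .
  obtain U where U: "open U" "p \<in> U" "uniform_limit U (\<lambda>n. ?F ^^ n) (\<lambda>_. (0, 0)) sequentially"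
    using p CS by (auto simp: attracting_basin_def)
  \<comment> \<open>Within distance \<open>\<delta>\<close> of the origin, \<open>\<bar>z\<bar> + \<bar>a w\<bar> < 1\<close>.\<close>
  define \<delta> where "\<delta> = 1 / (1 + cmod a)"
  have \<delta>: "0 < \<delta>" "(1 + cmod a) * \<delta> = 1"
    using add_pos_nonneg[OF zero_less_one norm_ge_zero[of a]] by (simp_all add: \<delta>_def)
  obtain m where m: "\<And>n y. \<lbrakk>m \<le> n; y \<in> U\<rbrakk> \<Longrightarrow> dist ((?F ^^ n) y) (0, 0) < \<delta>"
    using uniform_limitD[OF U(3) \<delta>(1)] by (auto simp: eventually_sequentially)
  define V where "V = (?F ^^ m) ` (U \<inter> C)"
  have V: "open V" "(?F ^^ m) p \<in> V"
    using U Cop p by (auto simp: V_def intro: opnk)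
  obtain q where q: "q \<in> V" "a * snd q \<noteq> fst q"
  proof (cases "a * snd ((?F ^^ m) p) = fst ((?F ^^ m) p)")
    case True
    obtain e where e: "0 < e" "ball ((?F ^^ m) p) e \<subseteq> V"
      using V by (meson openE)
    \<comment> \<open>A vertical shift leaves the line because \<open>a \<noteq> 0\<close>.\<close>
    define q where "q = (fst ((?F ^^ m) p), snd ((?F ^^ m) p) + of_real (e / 2))"
    have "dist ((?F ^^ m) p) q = e / 2"
      using e(1) by (simp add: q_def dist_prod_def dist_norm)
    then have "q \<in> V"
      using e by (intro subsetD[OF e(2)]) simp
    moreover have "a * snd q \<noteq> fst q"
      using True a e(1) by (simp add: q_def distrib_left)
    ultimately show ?thesis
      using that by blast
  qed (use V that in blast)
  obtain y where y: "y \<in> U" "y \<in> C" "q = (?F ^^ m) y"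
    using q(1) by (auto simp: V_def)
  define Z W where "Z n = fst ((?F ^^ n) q)" and "W n = snd ((?F ^^ n) q)" for n
  have orbit: "(?F ^^ n) q = (Z n, W n)" for n
    by (simp add: Z_def W_def)
  have shift: "(?F ^^ n) q = (?F ^^ (n + m)) y" for n
    by (simp add: y(3) funpow_add)
  have small: "cmod (Z n) + cmod (a * W n) < 1" for n
  proof -
    have d: "norm ((?F ^^ n) q) < \<delta>"
      using m[of "n + m" y] y(1) by (simp add: shift dist_norm zero_prod_def[symmetric])
    have z1: "cmod (Z n) < \<delta>" and w1: "cmod (W n) < \<delta>"
      using d norm_fst_le[of "Z n" "W n"] norm_snd_le[of "W n" "Z n"] by (simp_all add: orbit)
    have "cmod (Z n) + cmod (a * W n) < \<delta> + cmod a * \<delta>"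
      unfolding norm_mult using z1 w1 by (intro add_less_le_mono mult_left_mono) auto
    then show ?thesis
      using \<delta>(2) by (simp add: algebra_simps)
  qed
  have qS: "q \<in> F_basin lam a"
    unfolding y(3) using attracting_basin_image_funpow[OF opn] y(2) CS by blast
  have lim: "(\<lambda>n. (Z n, W n)) \<longlonglongrightarrow> (0, 0)"
    using attracting_basin_tendsto[OF qS] by (simp add: orbit)
  have "\<exists>n. (?F ^^ n) q \<in> local_basin \<epsilon>"
  proof (rule enters_local_basin[OF lam a \<epsilon>(1) orbit])
    show "Z \<longlonglongrightarrow> 0" "W \<longlonglongrightarrow> 0"
      using tendsto_fst[OF lim] tendsto_snd[OF lim] by simp_all
    show "Z n \<noteq> 0" for n
      using fst_F_basin[OF attracting_basin_image_funpow[OF opn qS, of n]] nonpos_notin_base_basin[of 0]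
      by (auto simp: Z_def)
    show "\<forall>n. a * W n \<noteq> Z n" if lam1: "lam = 1"
    proof
      fix n show "a * W n \<noteq> Z n"
      proof (induction n)
        case 0
        then show ?case
          using q(2) by (simp add: Z_def W_def)
      next
        case (Suc n)
        have "Z (Suc n) - a * W (Suc n) = base_map (Z n - a * W n)"
          using F_map_1_line_coord[of a "(?F ^^ n) q"] by (simp add: Z_def W_def lam1)
        then have "Z (Suc n) - a * W (Suc n) = (Z n - a * W n) * (1 - (Z n - a * W n))"
          by (simp add: base_map_def power2_eq_square right_diff_distrib)
        moreover have "1 - (Z n - a * W n) \<noteq> 0"
          using norm_triangle_ineq4[of "Z n" "a * W n"] small[of n] by auto
        ultimately show ?case
          using Suc by auto
      qed
    qed
  qed
  then obtain n where n: "(?F ^^ (n + m)) y \<in> local_basin \<epsilon>"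
    by (auto simp: shift)
  obtain T where T: "connected T" "T \<subseteq> F_basin lam a" "(?F ^^ (n + m)) y \<in> T" "(z, 0) \<in> T"
    using local_basin_joined_to_axis[OF lam \<epsilon> n z] by blast
  have "(?F ^^ (n + m)) ` C \<in> components (F_basin lam a)"
    using continuous_on_F_map opn F_map_proper[OF a] C by (rule image_component_funpow_proper_open)
  then have "T \<subseteq> (?F ^^ (n + m)) ` C"
    using T(1,2) by (rule components_maximal) (use T(3) y(2) in blast)
  then obtain x where "x \<in> C" "(?F ^^ (n + m)) x = (z, 0)"
    using T(4) by (metis imageE subsetD)
  then show ?thesis
    by (metis fst_conv fst_funpow_F_map)
qed

text \<open>For \<open>a = 0\<close> the fibre maps are linear, so the slope of the cone \<open>\<bar>w\<bar> < \<epsilon> \<bar>z\<bar>\<close> is arbitrary.\<close>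

lemma linear_F_basin:
  assumes lam: "0 < lam" "lam \<le> 1" and z: "z \<in> base_basin"
  shows "(z, w) \<in> F_basin lam 0"
proof -
  obtain n where n: "(base_map ^^ n) z \<in> petal"
    using base_basin_enters_petal[OF z] by blast
  define x where "x = (F_map lam 0 ^^ n) (z, w)"
  have fst: "fst x = (base_map ^^ n) z"
    by (simp add: x_def fst_funpow_F_map)
  have pos: "0 < cmod (fst x)"
    using petal_nonzero[OF n] by (simp add: fst)
  define \<epsilon> where "\<epsilon> = cmod (snd x) / cmod (fst x) + 1"
  have "x \<in> local_basin \<epsilon>"
    using n pos by (simp add: local_basin_def fst \<epsilon>_def distrib_right)
  then have "x \<in> F_basin lam 0"
    using local_basin_subset[of lam 0 \<epsilon>] lam by auto
  then show ?thesis
    unfolding x_def by (rule attracting_basin_vimage_funpow[OF continuous_on_F_map])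
qed

text \<open>Here \<open>F\<close> collapses the fibre over \<open>\<lambda> / 2\<close> and is not open. But the basin is a product, and \<open>p\<close> is open and
  proper; so the component of the base is iterated instead and lifted back at constant \<open>w\<close>.\<close>

lemma component_reaches_tract_linear:
  assumes lam: "0 < lam" "lam \<le> 1"
    and C: "C \<in> components (F_basin lam 0)" and z: "tract_height < Im (1 / z)"
  shows "\<exists>k. \<exists>x\<in>C. (base_map ^^ k) (fst x) = z"
proof -
  obtain y w where yw: "(y, w) \<in> C"
    using in_components_nonempty[OF C] by auto
  then have y: "y \<in> base_basin"
    using in_components_subset[OF C] fst_F_basin by force
  define B where "B = connected_component_set base_basin y"
  have B: "B \<in> components base_basin" "y \<in> B"
    using y by (auto simp: B_def componentsI connected_component_refl)
  obtain n where n: "(base_map ^^ n) y \<in> petal"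
    using base_basin_enters_petal[OF y] by blast
  then have axis: "((base_map ^^ n) y, 0) \<in> local_basin 1"
    using petal_nonzero[OF n] by (simp add: local_basin_def)
  have "\<exists>T. connected T \<and> T \<subseteq> F_basin lam 0 \<and> ((base_map ^^ n) y, 0) \<in> T \<and> (z, 0) \<in> T"
    by (rule local_basin_joined_to_axis[OF lam _ _ axis z]) simp_all
  then obtain T where T: "connected T" "T \<subseteq> F_basin lam 0" "((base_map ^^ n) y, 0) \<in> T" "(z, 0) \<in> T"
    by blast
  have fT: "connected (fst ` T)" "fst ` T \<subseteq> base_basin" "(base_map ^^ n) y \<in> fst ` T" "z \<in> fst ` T"
    using T fst_F_basin by (force intro: connected_continuous_image continuous_intros)+
  have "(base_map ^^ n) ` B \<in> components base_basin"
    using continuous_on_base_map open_image_base_map base_map_proper B(1)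
    by (rule image_component_funpow_proper_open)
  then have "fst ` T \<subseteq> (base_map ^^ n) ` B"
    using fT(1,2) by (rule components_maximal) (use fT(3) B(2) in blast)
  then obtain z\<^sub>0 where z0: "z\<^sub>0 \<in> B" "(base_map ^^ n) z\<^sub>0 = z"
    using fT(4) by (metis imageE subsetD)
  have "connected (B \<times> {w})"
    using in_components_connected[OF B(1)] by (intro connected_Times) auto
  moreover have "B \<times> {w} \<subseteq> F_basin lam 0"
    using in_components_subset[OF B(1)] linear_F_basin[OF lam] by auto
  ultimately have "B \<times> {w} \<subseteq> C"
    using yw B(2) by (intro components_maximal[OF C]) auto
  then show ?thesis
    using z0 by force
qed

lemma component_reaches_tract:
  assumes "0 < lam" "lam \<le> 1" "C \<in> components (F_basin lam a)" "tract_height < Im (1 / z)"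
  shows "\<exists>k. \<exists>x\<in>C. (base_map ^^ k) (fst x) = z"
  using component_reaches_tract_nonlinear component_reaches_tract_linear assms by (cases "a = 0") blast+

section \<open>Distance from the grand orbit\<close>

lemma grand_orbit_base_real:
  assumes "x \<in> grand_orbit (F_map lam a) (of_real r, 0)"
  shows "\<exists>m. (base_map ^^ m) (fst x) \<in> \<real>"
proof -
  obtain m n where "(F_map lam a ^^ m) x = (F_map lam a ^^ n) (of_real r, 0)"
    using assms by (auto simp: grand_orbit_def)
  then have "(base_map ^^ m) (fst x) = (base_map ^^ n) (of_real r)"
    by (metis fst_conv fst_funpow_F_map)
  moreover have "(base_map ^^ n) (of_real r) \<in> \<real>"
    by (induction n) (auto simp: base_map_def)
  ultimately show ?thesis
    by metis
qed

text \<open>The disc-valued map is \<open>cayley v \<circ> slit_coord \<circ> p\<^sup>k\<close> on the first coordinate; the slit is avoided because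
  the basin of \<open>p\<close> is invariant.\<close>

lemma kobayashi_dist_ge_via_base:
  assumes X: "X \<subseteq> F_basin lam a" and x: "x \<in> X" and v: "0 < Re v"
    and xk: "slit_coord ((base_map ^^ k) (fst x)) = v"
  shows "kobayashi_dist X x y \<ge> ereal (artanh (cmod (cayley v (slit_coord ((base_map ^^ k) (fst y))))))"
proof -
  define \<phi> where "\<phi> x = cayley v (slit_coord ((base_map ^^ k) (fst x)))" for x :: "complex \<times> complex"
  have slit: "1 / (base_map ^^ k) (fst x) - 1 \<notin> \<real>\<^sub>\<le>\<^sub>0" if "x \<in> X" for x
  proof (rule base_basin_slit)
    show "(base_map ^^ k) (fst x) \<in> base_basin"
      using fst_F_basin[OF subsetD[OF X that]] by (rule funpow_in_base_basin)
  qed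
  then have Re: "0 < Re (slit_coord ((base_map ^^ k) (fst x)))" if "x \<in> X" for x
    unfolding slit_coord_def using that by (intro Re_csqrt_pos slit)
  have hol_iter: "(base_map ^^ k) holomorphic_on UNIV"
  proof (induction k)
    case (Suc k)
    then show ?case
      using holomorphic_on_compose[OF Suc base_map_holomorphic] by (simp add: comp_def)
  qed (simp add: id_def)
  have "ereal (artanh (cmod (\<phi> y))) \<le> kobayashi_dist X x y"
  proof (rule kobayashi_dist_ge_of_disc_map)
    fix f assume f: "holomorphic_disc X f"
    then have fX: "f t \<in> X" if "t \<in> ball 0 1" for t
      using that by (auto simp: holomorphic_disc_def)
    have nz: "(base_map ^^ k) (fst (f t)) \<noteq> 0" if "t \<in> ball 0 1" for t
      using slit[OF fX[OF that]] by auto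
    have ne: "slit_coord ((base_map ^^ k) (fst (f t))) + cnj v \<noteq> 0" if "t \<in> ball 0 1" for t
      using Re[OF fX[OF that]] v by (auto simp: complex_eq_iff)
    have "(\<lambda>t. fst (f t)) holomorphic_on ball 0 1"
      using f by (simp add: holomorphic_disc_def)
    then have "(\<lambda>t. (base_map ^^ k) (fst (f t))) holomorphic_on ball 0 1"
      using holomorphic_on_compose_gen[OF _ hol_iter] by (simp add: comp_def)
    then have "(\<lambda>t. slit_coord ((base_map ^^ k) (fst (f t)))) holomorphic_on ball 0 1"
      unfolding slit_coord_def using slit[OF fX] nz by (intro holomorphic_intros) auto
    then show "(\<phi> \<circ> f) holomorphic_on ball 0 1"
      unfolding \<phi>_def cayley_def comp_def using ne by (intro holomorphic_intros) auto
  next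
    show "\<phi> ` X \<subseteq> ball 0 1"
      using Re v by (auto simp: \<phi>_def norm_cayley_less_1)
    show "\<phi> x = 0"
      by (simp add: \<phi>_def xk cayley_def)
  qed
  then show ?thesis
    by (simp add: \<phi>_def)
qed

theorem theorem2p2:
  fixes lam :: real and a :: complex
  assumes "0 < lam" and "lam \<le> 1"
  shows "\<forall>\<Omega>\<^sub>\<alpha> \<in> components (attracting_basin (F_map lam a) (0, 0)). \<forall>C::real. C > 0 \<longrightarrow>
           (\<exists>z\<^sub>0 w\<^sub>\<alpha>. (z\<^sub>0, w\<^sub>\<alpha>) \<in> \<Omega>\<^sub>\<alpha> \<and>
             (\<forall>z w. (z, w) \<in> grand_orbit (F_map lam a) (1/2, 0) \<inter> \<Omega>\<^sub>\<alpha> \<longrightarrow>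
                kobayashi_dist \<Omega>\<^sub>\<alpha> (z\<^sub>0, w\<^sub>\<alpha>) (z, w) \<ge> ereal C))"
proof (intro ballI allI impI)
  fix X and C :: real
  assume X: "X \<in> components (F_basin lam a)" and C: "0 < C"
  have XS: "X \<subseteq> F_basin lam a"
    using X by (rule in_components_subset)
  have e0: "0 \<le> tract_height"
    using tract_height_pos by simp
  obtain t where t: "tract_height < t"
    and far: "\<And>z. \<lbrakk>1 / z - 1 \<notin> \<real>\<^sub>\<le>\<^sub>0; \<bar>Im (1 / z)\<bar> \<le> tract_height\<rbrakk> \<Longrightarrow>
        C \<le> artanh (cmod (cayley (Complex 1 t) (slit_coord z)))"
    using cayley_slit_coord_far[OF C e0] by metis
  \<comment> \<open>The point of the base with half-plane coordinate \<open>1 + \<i> t\<close>.\<close>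
  define z\<^sub>1 where "z\<^sub>1 = 1 / (1 + (Complex 1 t)\<^sup>2)"
  have rec: "1 / z\<^sub>1 = 1 + (Complex 1 t)\<^sup>2"
    by (simp add: z\<^sub>1_def)
  have "0 < t"
    using t e0 by linarith
  then have "tract_height < Im (1 / z\<^sub>1)"
    unfolding rec using t by (simp add: power2_eq_square)
  then obtain k z\<^sub>0 w\<^sub>0 where k: "(z\<^sub>0, w\<^sub>0) \<in> X" "(base_map ^^ k) z\<^sub>0 = z\<^sub>1"
    using component_reaches_tract[OF assms X] by force
  have slit1: "slit_coord ((base_map ^^ k) (fst (z\<^sub>0, w\<^sub>0))) = Complex 1 t"
    unfolding fst_conv k(2) slit_coord_def rec by (rule csqrt_unique) simp_all
  have "kobayashi_dist X (z\<^sub>0, w\<^sub>0) (z, w) \<ge> ereal C"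
    if S: "(z, w) \<in> grand_orbit (F_map lam a) (1/2, 0) \<inter> X" for z w
  proof -
    obtain m where m: "(base_map ^^ m) z \<in> \<real>"
      using grand_orbit_base_real[of "(z, w)" lam a "1/2"] S by auto
    \<comment> \<open>The \<open>k\<close>-th iterate of the orbit point also has a real iterate, so the height bound applies to it.\<close>
    have "(base_map ^^ m) ((base_map ^^ k) z) = (base_map ^^ k) ((base_map ^^ m) z)"
      by (metis add.commute comp_apply funpow_add)
    moreover have "(base_map ^^ k) r \<in> \<real>" if "r \<in> \<real>" for r
      using that by (induction k) (auto simp: base_map_def)
    ultimately have "(base_map ^^ m) ((base_map ^^ k) z) \<in> \<real>"
      using m by simp
    then have im: "\<bar>Im (1 / (base_map ^^ k) z)\<bar> \<le> tract_height"
      by (rule Im_recip_le_of_real_orbit)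
    have "z \<in> base_basin"
      using S XS fst_F_basin by force
    then have "(base_map ^^ k) z \<in> base_basin"
      by (rule funpow_in_base_basin)
    then have "C \<le> artanh (cmod (cayley (Complex 1 t) (slit_coord ((base_map ^^ k) z))))"
      by (intro far base_basin_slit im)
    then show ?thesis
      using kobayashi_dist_ge_via_base[OF XS k(1) _ slit1, of "(z, w)"]
      by (simp add: order_trans[rotated])
  qed
  then show "\<exists>z\<^sub>0 w\<^sub>\<alpha>. (z\<^sub>0, w\<^sub>\<alpha>) \<in> X \<and>
             (\<forall>z w. (z, w) \<in> grand_orbit (F_map lam a) (1/2, 0) \<inter> X \<longrightarrow>
                kobayashi_dist X (z\<^sub>0, w\<^sub>\<alpha>) (z, w) \<ge> ereal C)"
    using k(1) by blast
qed

end
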